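(* For every $\varepsilon>0$ there is an integer $q\geq 1$ such that for every $N\geq 1$, if $f:\mathbb{T}^N\to\mathbb{R}$ is $1$-Lipschitz for the metric $|\cdot|^N_\infty$, then there is some $S\subseteq[N]$ with $|S|\leq q$ such that \[\|f-E_Sf\|_{L_1(\mathbb{T}^N)}<\varepsilon.\]
   Context: $\mathbb{T}:=\mathbb{R}/\mathbb{Z}$ with the metric inherited from the usual distance on $\mathbb{R}$, denoted $|\cdot|$ (distance between two points is the minimal distance between representatives). On $\mathbb{T}^N$, $|\cdot|^N_\infty$ is the $\ell_\infty$-product metric, i.e. the maximum over $n\leq N$ of the coordinate distances. $L_1(\mathbb{T}^N)$ is with respect to the Haar probability measure. $[N]=\{1,\ldots,N\}$. For $S\subseteq[N]$, $E_Sf$ is the conditional expectation obtained by integrating out (with respect to Haar probability measure on $\mathbb{T}$) all coordinates $n\in[N]\setminus S$; it depends only on the coordinates in $S$. *)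

theory Defs
  imports "HOL-Probability.Probability"
begin

section \<open>The circle group\<close>

quotient_type circle = real / "\<lambda>x y :: real. x - y \<in> \<int>"
  morphisms rep_circle to_circle
proof (rule equivpI)
  show "reflp (\<lambda>x y :: real. x - y \<in> \<int>)" by (auto intro: reflpI)
  show "symp (\<lambda>x y :: real. x - y \<in> \<int>)"
    by (rule sympI) (use Ints_minus in fastforce)
  show "transp (\<lambda>x y :: real. x - y \<in> \<int>)"
  proof (rule transpI)
    fix x y z :: real assume "x - y \<in> \<int>" "y - z \<in> \<int>"
    then have "(x - y) + (y - z) \<in> \<int>" by (rule Ints_add)
    then show "x - z \<in> \<int>" by simp
  qed
qed

lemma to_circle_eq_iff: "to_circle x = to_circle y \<longleftrightarrow> x - y \<in> \<int>"
  using circle.abs_eq_iff by simp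

lemma to_circle_surj: "\<exists>x. a = to_circle x"
  by (induct a rule: circle.abs_induct) blast

instantiation circle :: ab_group_add
begin

lift_definition zero_circle :: circle is 0 .
lift_definition plus_circle :: "circle \<Rightarrow> circle \<Rightarrow> circle" is "(+)"
proof -
  fix a b c d :: real assume "a - b \<in> \<int>" "c - d \<in> \<int>"
  then have "(a - b) + (c - d) \<in> \<int>" by (rule Ints_add)
  then show "a + c - (b + d) \<in> \<int>" by (simp add: algebra_simps)
qed
lift_definition uminus_circle :: "circle \<Rightarrow> circle" is "uminus"
proof -
  fix a b :: real assume "a - b \<in> \<int>"
  then have "- (a - b) \<in> \<int>" by (rule Ints_minus)
  then show "- a - - b \<in> \<int>" by simp
qed
lift_definition minus_circle :: "circle \<Rightarrow> circle \<Rightarrow> circle" is "(-)"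
proof -
  fix a b c d :: real assume "a - b \<in> \<int>" "c - d \<in> \<int>"
  then have "(a - b) - (c - d) \<in> \<int>" by (rule Ints_diff)
  then show "a - c - (b - d) \<in> \<int>" by (simp add: algebra_simps)
qed

instance
  by standard (transfer; simp add: algebra_simps)+

end

definition representative_distances :: "circle \<Rightarrow> circle \<Rightarrow> real set" where
  "representative_distances a b = {\<bar>x - y\<bar> | x y. to_circle x = a \<and> to_circle y = b}"

lemma representative_distances_to_circle:
  "representative_distances (to_circle x) (to_circle y) = {\<bar>x - y + of_int k\<bar> | k. True}"
proof (intro set_eqI iffI)
  fix d assume "d \<in> representative_distances (to_circle x) (to_circle y)"
  then obtain u v where d: "d = \<bar>u - v\<bar>" and u: "u - x \<in> \<int>" and v: "v - y \<in> \<int>"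
    by (auto simp: representative_distances_def to_circle_eq_iff)
  from Ints_diff[OF u v] obtain k where "(u - x) - (v - y) = of_int k" by (auto elim: Ints_cases)
  then have "u - v = x - y + of_int k" by simp
  with d show "d \<in> {\<bar>x - y + of_int k\<bar> | k. True}" by auto
next
  fix d assume "d \<in> {\<bar>x - y + of_int k\<bar> | k. True}"
  then obtain k where "d = \<bar>(x + of_int k) - y\<bar>" by (auto simp: algebra_simps)
  moreover have "to_circle (x + of_int k) = to_circle x" by (simp add: to_circle_eq_iff)
  ultimately show "d \<in> representative_distances (to_circle x) (to_circle y)"
    unfolding representative_distances_def by blast
qed

lemma representative_distance_minimal:
  "\<bar>x - y - of_int (round (x - y))\<bar> \<le> \<bar>x - y + of_int k\<bar>"
  using round_diff_minimal[of "x - y" "- k"] by simp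

instantiation circle :: metric_space
begin

text \<open>The infimum is attained, see \<open>dist_circle_attained\<close> below.\<close>

definition dist_circle :: "circle \<Rightarrow> circle \<Rightarrow> real" where
  "dist_circle a b = Inf (representative_distances a b)"

definition uniformity_circle :: "(circle \<times> circle) filter" where
  "uniformity_circle = (INF e\<in>{0<..}. principal {(x, y). dist x y < e})"

definition open_circle :: "circle set \<Rightarrow> bool" where
  "open_circle U \<longleftrightarrow> (\<forall>x\<in>U. \<forall>\<^sub>F (x', y) in uniformity. x' = x \<longrightarrow> y \<in> U)"

lemma dist_to_circle_round:
  "dist (to_circle x) (to_circle y) = \<bar>x - y - of_int (round (x - y))\<bar>"
  unfolding dist_circle_def representative_distances_to_circle
proof (rule cInf_eq_minimum)
  have "\<bar>x - y - of_int (round (x - y))\<bar> = \<bar>x - y + of_int (- round (x - y))\<bar>" by simp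
  then show "\<bar>x - y - of_int (round (x - y))\<bar> \<in> {\<bar>x - y + of_int k\<bar> | k. True}"
    by blast
next
  fix d assume "d \<in> {\<bar>x - y + of_int k\<bar> | k. True}"
  then show "\<bar>x - y - of_int (round (x - y))\<bar> \<le> d"
    using representative_distance_minimal by auto
qed

lemma dist_to_circle_le: "dist (to_circle x) (to_circle y) \<le> \<bar>x - y + of_int k\<bar>"
  unfolding dist_to_circle_round by (rule representative_distance_minimal)

instance
proof
  fix a b c :: circle
  obtain x y z where xyz: "a = to_circle x" "b = to_circle y" "c = to_circle z"
    using to_circle_surj by metis
  show "dist a b = 0 \<longleftrightarrow> a = b"
  proof
    assume "dist a b = 0"
    then have "x - y = of_int (round (x - y))" by (simp add: xyz dist_to_circle_round)
    then show "a = b" unfolding xyz to_circle_eq_iff by (metis Ints_of_int)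
  next
    assume "a = b"
    then show "dist a b = 0"
      using dist_to_circle_round[of x x] by (simp add: xyz)
  qed
  let ?k = "round (x - z)" and ?l = "round (y - z)"
  have "dist a b \<le> \<bar>x - y + of_int (?l - ?k)\<bar>"
    unfolding xyz by (rule dist_to_circle_le)
  also have "\<dots> = \<bar>(x - z - of_int ?k) - (y - z - of_int ?l)\<bar>" by simp
  also have "\<dots> \<le> dist a c + dist b c"
    unfolding xyz dist_to_circle_round by linarith
  finally show "dist a b \<le> dist a c + dist b c" .
qed (simp_all only: uniformity_circle_def open_circle_def)

end

lemma dist_circle_attained:
  "\<exists>x y. to_circle x = a \<and> to_circle y = b \<and> dist a b = \<bar>x - y\<bar>"
proof -
  obtain u v where uv: "a = to_circle u" "b = to_circle v" using to_circle_surj by metis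
  show ?thesis
  proof (intro exI conjI)
    show "to_circle (u - of_int (round (u - v))) = a" "to_circle v = b"
      by (simp_all add: uv to_circle_eq_iff)
    show "dist a b = \<bar>u - of_int (round (u - v)) - v\<bar>"
      unfolding uv dist_to_circle_round by (simp add: algebra_simps)
  qed
qed

lemma dist_to_circle: "dist (to_circle x) (to_circle y) \<le> dist x y"
  using dist_to_circle_le[of x y 0] by (simp add: dist_real_def)

lemma continuous_on_to_circle: "continuous_on A to_circle"
  unfolding continuous_on_iff using dist_to_circle by (meson le_less_trans)

lemma to_circle_measurable [measurable]: "to_circle \<in> borel_measurable borel"
  by (rule borel_measurable_continuous_onI) (rule continuous_on_to_circle)


section \<open>Haar measure\<close>

definition haar :: "circle measure" where
  "haar = distr (restrict_space lborel {0..<1}) borel to_circle"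

lemma space_haar [simp]: "space haar = UNIV"
  and sets_haar [simp, measurable_cong]: "sets haar = sets borel"
  by (simp_all add: haar_def)

lemma emeasure_haar:
  assumes "A \<in> sets borel"
  shows "emeasure haar A = emeasure lborel {x \<in> {0..<1}. to_circle x \<in> A}"
proof -
  have "to_circle \<in> restrict_space lborel {0..<1} \<rightarrow>\<^sub>M borel"
    by (rule measurable_restrict_space1) simp
  then have "emeasure haar A
      = emeasure (restrict_space lborel {0..<1}) (to_circle -` A \<inter> {0..<1})"
    unfolding haar_def using assms by (subst emeasure_distr) (auto simp: space_restrict_space)
  also have "\<dots> = emeasure lborel (to_circle -` A \<inter> {0..<1})"
    by (rule emeasure_restrict_space) auto
  also have "to_circle -` A \<inter> {0..<1} = {x \<in> {0..<1}. to_circle x \<in> A}" by auto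
  finally show ?thesis .
qed

lemma prob_space_haar: "prob_space haar"
proof (rule prob_spaceI)
  have "{x :: real. 0 \<le> x \<and> x < 1} = {0..<1}" by auto
  then show "emeasure haar (space haar) = 1" by (simp add: emeasure_haar)
qed

interpretation haar: prob_space haar
  by (rule prob_space_haar)

lemma dist_add_circle: "dist (c + a) (c + b) = dist a (b :: circle)"
proof -
  obtain x y z where xyz: "a = to_circle x" "b = to_circle y" "c = to_circle z"
    using to_circle_surj by metis
  show ?thesis unfolding xyz plus_circle.abs_eq dist_to_circle_round by simp
qed

lemma haar_translation_invariant: "distr haar borel ((+) c) = haar"
proof (rule measure_eqI)
  show "sets (distr haar borel ((+) c)) = sets haar" by simp
next
  fix A assume "A \<in> sets (distr haar borel ((+) c))"
  then have A [measurable]: "A \<in> sets borel" by simp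
  have cont: "continuous_on UNIV ((+) c)"
    unfolding continuous_on_iff dist_add_circle by blast
  have plus [measurable]: "(+) c \<in> borel_measurable borel"
    by (rule borel_measurable_continuous_onI) (rule cont)
  have A': "(+) c -` A \<in> sets borel"
    using measurable_sets_borel[OF plus A] by simp
  obtain t0 where "c = to_circle t0" using to_circle_surj by metis
  moreover define t where "t = frac t0"
  ultimately have c: "c = to_circle t"
    by (simp add: to_circle_eq_iff frac_def)
  have t: "0 \<le> t" "t < 1" by (simp_all add: t_def frac_ge_0 frac_lt_1)
  let ?P = "\<lambda>x. to_circle x \<in> A"
  have [measurable]: "Measurable.pred borel ?P" by measurable
  have per: "?P (x - 1) = ?P x" for x
  proof -
    have "to_circle (x - 1) = to_circle x" by (simp add: to_circle_eq_iff)
    then show ?thesis by simp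
  qed
  have shift: "emeasure lborel {x. Q (a + x)} = emeasure lborel {x. Q x}"
    if Q: "Measurable.pred borel Q" for a :: real and Q
  proof -
    have "emeasure lborel {x. Q x} = emeasure (distr lborel borel ((+) a)) {x. Q x}"
      by (simp add: lborel_distr_plus)
    also have "\<dots> = emeasure lborel {x. Q (a + x)}"
      using Q by (subst emeasure_distr) (auto simp: vimage_def pred_def)
    finally show ?thesis by simp
  qed
  have "emeasure (distr haar borel ((+) c)) A = emeasure haar ((+) c -` A)"
    by (subst emeasure_distr) auto
  also have "\<dots> = emeasure lborel {x. t \<le> t + x \<and> t + x < t + 1 \<and> ?P (t + x)}"
    unfolding emeasure_haar[OF A'] by (simp add: c plus_circle.abs_eq vimage_def)
  also have "\<dots> = emeasure lborel {x. t \<le> x \<and> x < t + 1 \<and> ?P x}"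
    by (rule shift) measurable
  also have "{x. t \<le> x \<and> x < t + 1 \<and> ?P x}
      = {x. t \<le> x \<and> x < 1 \<and> ?P x} \<union> {x. 1 \<le> x \<and> x < t + 1 \<and> ?P x}"
    using t by auto
  also have "emeasure lborel \<dots>
      = emeasure lborel {x. t \<le> x \<and> x < 1 \<and> ?P x} + emeasure lborel {x. 1 \<le> x \<and> x < t + 1 \<and> ?P x}"
    by (rule plus_emeasure[symmetric]) auto
  also have "emeasure lborel {x. 1 \<le> x \<and> x < t + 1 \<and> ?P x}
      = emeasure lborel {x. 0 \<le> - 1 + x \<and> - 1 + x < t \<and> ?P (- 1 + x)}"
    using per by (simp add: algebra_simps)
  also have "\<dots> = emeasure lborel {x. 0 \<le> x \<and> x < t \<and> ?P x}"
    by (rule shift) measurable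
  also have "emeasure lborel {x. t \<le> x \<and> x < 1 \<and> ?P x} + \<dots>
      = emeasure lborel ({x. t \<le> x \<and> x < 1 \<and> ?P x} \<union> {x. 0 \<le> x \<and> x < t \<and> ?P x})"
    by (rule plus_emeasure) auto
  also have "{x. t \<le> x \<and> x < 1 \<and> ?P x} \<union> {x. 0 \<le> x \<and> x < t \<and> ?P x}
      = {x \<in> {0..<1}. ?P x}"
    using t by auto
  also have "emeasure lborel \<dots> = emeasure haar A"
    by (rule emeasure_haar[OF A, symmetric])
  finally show "emeasure (distr haar borel ((+) c)) A = emeasure haar A" .
qed


section \<open>Tori\<close>

text \<open>Points of the torus over an index set \<open>I\<close> are the functions in
  \<open>I \<rightarrow>\<^sub>E UNIV\<close>, which is the space of the following product measure.\<close>

definition torus_haar :: "nat set \<Rightarrow> (nat \<Rightarrow> circle) measure" where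
  "torus_haar I = (\<Pi>\<^sub>M i\<in>I. haar)"

lemma space_torus_haar: "space (torus_haar I) = (I \<rightarrow>\<^sub>E UNIV)"
  by (simp add: torus_haar_def space_PiM)

text \<open>Meaningful only for \<open>N \<ge> 1\<close>, since \<open>Max\<close> is unspecified on the empty set.\<close>

definition torus_dist :: "nat \<Rightarrow> (nat \<Rightarrow> circle) \<Rightarrow> (nat \<Rightarrow> circle) \<Rightarrow> real" where
  "torus_dist N x y = (MAX n\<in>{1..N}. dist (x n) (y n))"

definition torus_1_lipschitz :: "nat \<Rightarrow> ((nat \<Rightarrow> circle) \<Rightarrow> real) \<Rightarrow> bool" where
  "torus_1_lipschitz N f \<longleftrightarrow>
     (\<forall>x \<in> {1..N} \<rightarrow>\<^sub>E UNIV. \<forall>y \<in> {1..N} \<rightarrow>\<^sub>E UNIV. \<bar>f x - f y\<bar> \<le> torus_dist N x y)"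

text \<open>The point at which \<open>f\<close> is evaluated has coordinate \<open>x n\<close> for \<open>n \<in> S\<close> and
  \<open>y n\<close> for \<open>n \<in> {1..N} - S\<close>.\<close>

definition torus_cond_exp ::
    "nat \<Rightarrow> nat set \<Rightarrow> ((nat \<Rightarrow> circle) \<Rightarrow> real) \<Rightarrow> (nat \<Rightarrow> circle) \<Rightarrow> real" where
  "torus_cond_exp N S f x =
     (\<integral>y. f (merge S ({1..N} - S) (x, y)) \<partial>torus_haar ({1..N} - S))"

definition torus_L1_norm :: "nat \<Rightarrow> ((nat \<Rightarrow> circle) \<Rightarrow> real) \<Rightarrow> real" where
  "torus_L1_norm N g = (\<integral>x. \<bar>g x\<bar> \<partial>torus_haar {1..N})"

text \<open>Well-definedness: Lipschitz functions and their conditional expectations are integrable,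
  so that the totalised Bochner integral never takes its default value above.\<close>

lemma torus_1_lipschitz_measurable:
  assumes N: "N \<ge> 1" and f: "torus_1_lipschitz N f"
  shows "f \<in> borel_measurable (torus_haar {1..N})"
proof -
  define D where "D = ({1..N} \<rightarrow>\<^sub>E to_circle ` \<rat>)"
  have countD: "countable D"
    unfolding D_def by (intro countable_PiE) (auto intro: countable_rat)
  have D_sub: "D \<subseteq> {1..N} \<rightarrow>\<^sub>E UNIV" by (auto simp: D_def PiE_def)
  let ?g = "\<lambda>d x. f d + torus_dist N x d"
  have g_meas: "?g d \<in> borel_measurable (torus_haar {1..N})" for d
  proof -
    have "(\<lambda>a. dist a (d n)) \<in> borel_measurable borel" for n
      by (intro borel_measurable_continuous_onI continuous_intros)
    then have "(\<lambda>x. dist (x n) (d n)) \<in> borel_measurable (torus_haar {1..N})" if "n \<in> {1..N}" for n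
      using that unfolding torus_haar_def by measurable
    then show ?thesis
      unfolding torus_dist_def using N
      by (intro borel_measurable_add borel_measurable_const borel_measurable_Max) auto
  qed
  have sym: "torus_dist N x d = torus_dist N d x" for x d
    by (simp add: torus_dist_def dist_commute)
  have lower: "f x \<le> ?g d x" "f d \<le> f x + torus_dist N x d"
    if "x \<in> {1..N} \<rightarrow>\<^sub>E UNIV" "d \<in> D" for x d
  proof -
    have "\<bar>f x - f d\<bar> \<le> torus_dist N x d"
      using f that D_sub unfolding torus_1_lipschitz_def by blast
    then show "f x \<le> ?g d x" "f d \<le> f x + torus_dist N x d" by linarith+
  qed
  have bdd: "bdd_below ((\<lambda>d. ?g d x) ` D)" if "x \<in> {1..N} \<rightarrow>\<^sub>E UNIV" for x
    using lower(1)[OF that] by (intro bdd_belowI2)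
  have approx: "\<exists>d\<in>D. torus_dist N x d < e" if "e > 0" for x and e :: real
  proof -
    have "\<exists>r\<in>\<rat>. dist (x n) (to_circle r) < e" for n
    proof -
      obtain t where t: "x n = to_circle t" using to_circle_surj by metis
      obtain r where "r \<in> \<rat>" "t - e < r" "r < t"
        using Rats_dense_in_real[of "t - e" t] \<open>e > 0\<close> by auto
      then have "dist t r < e" by (simp add: dist_real_def)
      then have "dist (to_circle t) (to_circle r) < e" by (rule le_less_trans[OF dist_to_circle])
      with \<open>r \<in> \<rat>\<close> show ?thesis unfolding t by blast
    qed
    then obtain r where r: "r n \<in> \<rat>" "dist (x n) (to_circle (r n)) < e" for n by metis
    let ?d = "restrict (\<lambda>n. to_circle (r n)) {1..N}"
    have "?d \<in> D" using r by (auto simp: D_def)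
    moreover have "torus_dist N x ?d < e"
      unfolding torus_dist_def using N r by (subst Max_less_iff) auto
    ultimately show ?thesis by blast
  qed
  have eq: "f x = (INF d\<in>D. ?g d x)" if x: "x \<in> {1..N} \<rightarrow>\<^sub>E UNIV" for x
  proof (rule antisym)
    have "D \<noteq> {}" using approx[of 1 x] by auto
    then show "f x \<le> (INF d\<in>D. ?g d x)"
      by (rule cINF_greatest) (rule lower(1)[OF x])
    show "(INF d\<in>D. ?g d x) \<le> f x"
    proof (rule field_le_epsilon)
      fix e :: real assume "e > 0"
      then obtain d where d: "d \<in> D" "torus_dist N x d < e / 2" using approx[of "e / 2" x] by auto
      have "(INF d\<in>D. ?g d x) \<le> ?g d x" by (rule cINF_lower[OF bdd[OF x] d(1)])
      also have "\<dots> \<le> f x + e" using lower(2)[OF x d(1)] d(2) by linarith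
      finally show "(INF d\<in>D. ?g d x) \<le> f x + e" .
    qed
  qed
  have "(\<lambda>x. INF d\<in>D. ?g d x) \<in> borel_measurable (torus_haar {1..N})"
    by (rule borel_measurable_cINF[OF countD g_meas]) (simp add: bdd space_torus_haar)
  then show ?thesis
    by (rule measurable_cong[THEN iffD1, rotated]) (simp add: eq space_torus_haar)
qed

lemma prob_space_torus_haar: "prob_space (torus_haar I)"
  unfolding torus_haar_def by (rule prob_space_PiM) (rule prob_space_haar)

lemma torus_1_lipschitz_bounded:
  assumes N: "N \<ge> 1" and f: "torus_1_lipschitz N f"
  obtains B where "\<And>x. x \<in> {1..N} \<rightarrow>\<^sub>E UNIV \<Longrightarrow> \<bar>f x\<bar> \<le> B"
proof
  let ?o = "restrict (\<lambda>_. 0) {1..N} :: nat \<Rightarrow> circle"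
  fix x :: "nat \<Rightarrow> circle" assume x: "x \<in> {1..N} \<rightarrow>\<^sub>E UNIV"
  have d: "dist a b \<le> 1" for a b :: circle
  proof -
    obtain u v where uv: "a = to_circle u" "b = to_circle v" using to_circle_surj by metis
    show ?thesis
      using of_int_round_abs_le[of "u - v"] unfolding uv dist_to_circle_round by linarith
  qed
  have "torus_dist N x ?o \<le> 1"
    unfolding torus_dist_def using N d by (subst Max_le_iff) auto
  moreover have "\<bar>f x - f ?o\<bar> \<le> torus_dist N x ?o"
    using f x unfolding torus_1_lipschitz_def by (meson UNIV_I restrict_PiE_iff)
  ultimately show "\<bar>f x\<bar> \<le> \<bar>f ?o\<bar> + 1" by linarith
qed

lemma torus_cond_exp_integrable:
  assumes N: "N \<ge> 1" and f: "torus_1_lipschitz N f" and S: "S \<subseteq> {1..N}"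
  shows "integrable (torus_haar {1..N}) f"
    and "\<And>x. x \<in> {1..N} \<rightarrow>\<^sub>E UNIV \<Longrightarrow>
           integrable (torus_haar ({1..N} - S)) (\<lambda>y. f (merge S ({1..N} - S) (x, y)))"
    and "integrable (torus_haar {1..N}) (torus_cond_exp N S f)"
proof -
  let ?T = "{1..N} - S"
  obtain B where B: "\<And>x. x \<in> {1..N} \<rightarrow>\<^sub>E UNIV \<Longrightarrow> \<bar>f x\<bar> \<le> B"
    using torus_1_lipschitz_bounded[OF N f] by blast
  note fm = torus_1_lipschitz_measurable[OF N f]
  interpret P: prob_space "torus_haar {1..N}" by (rule prob_space_torus_haar)
  interpret Q: prob_space "torus_haar ?T" by (rule prob_space_torus_haar)
  have un: "S \<union> ?T = {1..N}" using S by auto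
  have mm: "merge S ?T \<in> (torus_haar S \<Otimes>\<^sub>M torus_haar ?T) \<rightarrow>\<^sub>M torus_haar {1..N}"
    using measurable_merge[of S ?T "\<lambda>_. haar"] unfolding torus_haar_def un .
  have rs: "(\<lambda>x. restrict x S) \<in> torus_haar {1..N} \<rightarrow>\<^sub>M torus_haar S"
    unfolding torus_haar_def by (rule measurable_restrict_subset[OF S])
  have "(\<lambda>p. (restrict (fst p) S, snd p)) \<in>
      (torus_haar {1..N} \<Otimes>\<^sub>M torus_haar ?T) \<rightarrow>\<^sub>M (torus_haar S \<Otimes>\<^sub>M torus_haar ?T)"
    using rs by measurable
  from measurable_compose[OF measurable_compose[OF this mm] fm]
  have joint: "(\<lambda>(x, y). f (merge S ?T (x, y))) \<in>
      borel_measurable (torus_haar {1..N} \<Otimes>\<^sub>M torus_haar ?T)"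
    by (simp add: case_prod_beta)
  have mem: "merge S ?T (x, y) \<in> {1..N} \<rightarrow>\<^sub>E UNIV" for x y :: "nat \<Rightarrow> circle"
    using S by (auto simp: merge_def PiE_def extensional_def)
  have bound: "f (merge S ?T (x, y)) \<le> B" "- B \<le> f (merge S ?T (x, y))" for x y
    using B[OF mem[of x y]] by linarith+
  show "integrable (torus_haar {1..N}) f"
    using fm B by (intro P.integrable_const_bound[where B = B]) (auto simp: space_torus_haar)
  show int: "integrable (torus_haar ?T) (\<lambda>y. f (merge S ?T (x, y)))"
    if x: "x \<in> {1..N} \<rightarrow>\<^sub>E UNIV" for x
  proof (rule Q.integrable_const_bound[where B = B])
    show "AE y in torus_haar ?T. norm (f (merge S ?T (x, y))) \<le> B" using B mem by auto
    show "(\<lambda>y. f (merge S ?T (x, y))) \<in> borel_measurable (torus_haar ?T)"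
      using measurable_compose_Pair1[OF _ joint, of x] x by (simp add: space_torus_haar)
  qed
  show "integrable (torus_haar {1..N}) (torus_cond_exp N S f)"
  proof (rule P.integrable_const_bound[where B = B])
    show "torus_cond_exp N S f \<in> borel_measurable (torus_haar {1..N})"
      unfolding torus_cond_exp_def by (rule Q.borel_measurable_lebesgue_integral[OF joint])
    have "\<bar>torus_cond_exp N S f x\<bar> \<le> B" if "x \<in> {1..N} \<rightarrow>\<^sub>E UNIV" for x
    proof -
      let ?g = "\<lambda>y. f (merge S ?T (x, y))"
      have "(\<integral>y. ?g y \<partial>torus_haar ?T) \<le> B"
        by (rule Q.integral_le_const[OF int[OF that]]) (rule AE_I2, rule bound)
      moreover have "- B \<le> (\<integral>y. ?g y \<partial>torus_haar ?T)"
        by (rule Q.integral_ge_const[OF int[OF that]]) (rule AE_I2, rule bound)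
      ultimately show ?thesis unfolding torus_cond_exp_def by linarith
    qed
    then show "AE x in torus_haar {1..N}. norm (torus_cond_exp N S f x) \<le> B"
      by (auto simp: space_torus_haar)
  qed
qed

end

theory Submission
  imports Defs
begin

text \<open>
  Sample the function on a grid of mesh \<open>1 / m\<close>, with \<open>m\<close> large depending on \<open>N\<close>, after averaging it
  over boxes of \<open>N\<close> grid points per coordinate. Being Lipschitz for the maximum metric then forces the
  absolute partial differences to sum to at most \<open>4 / m\<close> at every point (a discrete version of the
  gradient being bounded in the dual norm). Let \<open>S\<close> consist of the coordinates whose
  \<open>L\<^sub>1\<close>-influence is at least \<open>\<delta>\<close>; there are at most \<open>4 / \<delta>\<close> of them.
  Average out the other coordinates one by one. Each martingale increment \<open>d\<close> has
  small \<open>L\<^sub>1\<close>-norm, so either its \<open>L\<^sub>2\<close>-norm is small as well, or the entropy of \<open>d\<^sup>2\<close> is at least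
  \<open>ln M\<close> times the mean of \<open>d\<^sup>2\<close>. By the logarithmic Sobolev inequality on the grid
  the entropies add up to at most a constant, hence the variance in the coordinates outside \<open>S\<close> is
  \<open>O(1 / ln M + M \<delta>)\<close>, independently of \<open>N\<close> and \<open>m\<close>.
\<close>

section \<open>Averages over a discrete grid\<close>

text \<open>Grid points are functions into the naturals: only averages are confined to the window
  below \<open>m\<close>, while forward differences and shifts may step out of it without wrapping
  around.\<close>

definition mean1 :: "nat \<Rightarrow> 'i \<Rightarrow> (('i \<Rightarrow> nat) \<Rightarrow> real) \<Rightarrow> ('i \<Rightarrow> nat) \<Rightarrow> real" where
  "mean1 m n F x = (\<Sum>k<m. F (x(n := k))) / real m"

primrec mean :: "nat \<Rightarrow> 'i list \<Rightarrow> (('i \<Rightarrow> nat) \<Rightarrow> real) \<Rightarrow> ('i \<Rightarrow> nat) \<Rightarrow> real" where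
  "mean m [] F = F"
| "mean m (n # ns) F = mean1 m n (mean m ns F)"

text \<open>The step is one grid cell and is not divided by its length, so \<open>m * fdiff\<close>
  plays the role of a partial derivative; hence the factors \<open>real m\<close> below.\<close>

definition fdiff :: "'i \<Rightarrow> (('i \<Rightarrow> nat) \<Rightarrow> real) \<Rightarrow> ('i \<Rightarrow> nat) \<Rightarrow> real" where
  "fdiff n F x = F (x(n := Suc (x n))) - F x"

lemma mean_add: "mean m ns (\<lambda>x. F x + G x) x = mean m ns F x + mean m ns G x"
  by (induction ns arbitrary: x) (simp_all add: mean1_def sum.distrib add_divide_distrib)

text \<open>Pull-out property of conditional expectations: \<open>H\<close> ignores the averaged
  coordinates and so acts as a constant.\<close>

lemma mean_mult_invariant:
  assumes "\<And>n k x. n \<in> set ns \<Longrightarrow> H (x(n := k)) = H x"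
  shows "mean m ns (\<lambda>x. H x * F x) x = H x * mean m ns F x"
  using assms
  by (induction ns arbitrary: x) (simp_all add: mean1_def sum_distrib_left)

lemma mean_cmult: "mean m ns (\<lambda>x. c * F x) x = c * mean m ns F x"
  by (rule mean_mult_invariant) simp

lemma mean_diff: "mean m ns (\<lambda>x. F x - G x) x = mean m ns F x - mean m ns G x"
  using mean_add[of m ns F "\<lambda>x. - 1 * G x" x] mean_cmult[of m ns "- 1" G x] by simp

lemma mean_divide: "mean m ns (\<lambda>x. F x / c) x = mean m ns F x / c"
  using mean_cmult[of m ns "1 / c" F x] by simp

lemma mean_sum: "mean m ns (\<lambda>x. \<Sum>i\<in>I. F i x) x = (\<Sum>i\<in>I. mean m ns (F i) x)"
proof (induction I rule: infinite_finite_induct)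
  case (insert i I)
  then show ?case by (simp add: mean_add)
qed (use mean_cmult[of m ns 0 "\<lambda>_. 0" x] in simp_all)

lemma mean_const:
  assumes "m > 0"
  shows "mean m ns (\<lambda>_. c) x = c"
  using assms by (induction ns arbitrary: x) (simp_all add: mean1_def)

text \<open>An average only visits points whose averaged coordinates lie below \<open>m\<close> and
  whose other coordinates are those of \<open>x\<close>.\<close>

lemma mean_mono_on:
  assumes "\<And>z. (\<forall>i\<in>set ns. z i < m) \<Longrightarrow> (\<forall>i. i \<notin> set ns \<longrightarrow> z i = x i) \<Longrightarrow> F z \<le> G z"
  shows "mean m ns F x \<le> mean m ns G x"
  using assms
proof (induction ns arbitrary: x)
  case (Cons n ns)
  have "mean m ns F (x(n := k)) \<le> mean m ns G (x(n := k))" if "k < m" for k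
  proof (rule Cons.IH)
    fix z assume z: "\<forall>i\<in>set ns. z i < m" "\<forall>i. i \<notin> set ns \<longrightarrow> z i = (x(n := k)) i"
    show "F z \<le> G z"
      by (rule Cons.prems) (use z that in \<open>force+\<close>)
  qed
  then show ?case by (auto simp: mean1_def intro!: divide_right_mono sum_mono)
qed simp

lemma mean_mono: "(\<And>z. F z \<le> G z) \<Longrightarrow> mean m ns F x \<le> mean m ns G x"
  by (rule mean_mono_on)

lemma mean_cong_on:
  assumes "\<And>z. (\<forall>i. i \<notin> set ns \<longrightarrow> z i = x i) \<Longrightarrow> F z = G z"
  shows "mean m ns F x = mean m ns G x"
  by (rule antisym; rule mean_mono_on; simp add: assms)

lemma mean_nonneg: "(\<And>z. 0 \<le> F z) \<Longrightarrow> 0 \<le> mean m ns F x"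
  using mean_mono[of "\<lambda>_. 0" F m ns x] mean_cmult[of m ns 0 "\<lambda>_. 0" x] by simp

lemma abs_mean_le: "\<bar>mean m ns F x\<bar> \<le> mean m ns (\<lambda>x. \<bar>F x\<bar>) x"
proof -
  have "mean m ns (\<lambda>x. - 1 * F x) x \<le> mean m ns (\<lambda>x. \<bar>F x\<bar>) x"
    by (rule mean_mono) simp
  moreover have "mean m ns F x \<le> mean m ns (\<lambda>x. \<bar>F x\<bar>) x"
    by (rule mean_mono) simp
  ultimately show ?thesis unfolding mean_cmult by linarith
qed

lemma abs_mean_le_bound:
  assumes "m > 0"
    and "\<And>z. (\<forall>i\<in>set ns. z i < m) \<Longrightarrow> (\<forall>i. i \<notin> set ns \<longrightarrow> z i = x i) \<Longrightarrow> \<bar>F z\<bar> \<le> c"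
  shows "\<bar>mean m ns F x\<bar> \<le> c"
proof -
  have "mean m ns (\<lambda>x. \<bar>F x\<bar>) x \<le> mean m ns (\<lambda>_. c) x"
    by (rule mean_mono_on) (rule assms(2))
  then show ?thesis using abs_mean_le[of m ns F x] mean_const[OF assms(1), of ns c x] by linarith
qed

section \<open>Commutation, tower property and orthogonality of averages\<close>

lemma mean1_commute: "mean1 m a (mean1 m b F) = mean1 m b (mean1 m a F)"
proof (cases "a = b")
  case False
  show ?thesis
  proof
    fix x
    have "mean1 m a (mean1 m b F) x = (\<Sum>k<m. \<Sum>l<m. F (x(a := k, b := l))) / real m / real m"
      by (simp add: mean1_def flip: sum_divide_distrib)
    also have "\<dots> = (\<Sum>l<m. \<Sum>k<m. F (x(b := l, a := k))) / real m / real m"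
      using False by (subst sum.swap) (simp add: fun_upd_twist)
    also have "\<dots> = mean1 m b (mean1 m a F) x"
      by (simp add: mean1_def flip: sum_divide_distrib)
    finally show "mean1 m a (mean1 m b F) x = mean1 m b (mean1 m a F) x" .
  qed
qed simp

lemma mean_mean1_commute: "mean m ns (mean1 m a F) = mean1 m a (mean m ns F)"
  by (induction ns) (simp_all add: mean1_commute[of m a])

lemma mean1_upd [simp]: "mean1 m n F (x(n := k)) = mean1 m n F x"
  by (simp add: mean1_def)

lemma mean_upd_same:
  assumes "n \<in> set ns"
  shows "mean m ns F (x(n := k)) = mean m ns F x"
  using assms
proof (induction ns arbitrary: x)
  case (Cons a ns)
  show ?case
  proof (cases "n = a")
    case False
    then have "n \<in> set ns" using Cons.prems by simp
    have "mean m ns F (x(n := k, a := j)) = mean m ns F (x(a := j))" for j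
      using Cons.IH[OF \<open>n \<in> set ns\<close>, of "x(a := j)"] fun_upd_twist[OF False, of x k j] by metis
    then show ?thesis unfolding mean.simps mean1_def by presburger
  qed (simp only: mean.simps mean1_upd)
qed simp

lemma mean_upd_other:
  assumes "n \<notin> set ns"
  shows "mean m ns F (x(n := k)) = mean m ns (\<lambda>x. F (x(n := k))) x"
  using assms
proof (induction ns arbitrary: x)
  case (Cons a ns)
  have "mean m ns F (x(n := k, a := j)) = mean m ns (\<lambda>x. F (x(n := k))) (x(a := j))" for j
    using Cons.IH[of "x(a := j)"] fun_upd_twist[of n a x k j] Cons.prems by (metis list.set_intros)
  then show ?case unfolding mean.simps mean1_def by presburger
qed simp

lemma mean1_idem:
  assumes "m > 0"
  shows "mean1 m n (mean1 m n F) = mean1 m n F"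
  using assms by (intro ext) (subst mean1_def, simp)

text \<open>Tower property: the inner average commutes past the other coordinates until it meets the
  average over the same coordinate, where idempotence removes it.\<close>

lemma mean_absorb1:
  assumes "m > 0" "t \<in> set ns"
  shows "mean m ns (mean1 m t F) = mean m ns F"
  using assms(2)
proof (induction ns)
  case (Cons a ns)
  show ?case
  proof (cases "t = a")
    case True
    then show ?thesis by (simp add: mean_mean1_commute mean1_idem[OF assms(1)])
  next
    case False
    then show ?thesis using Cons by simp
  qed
qed simp

lemma mean_absorb:
  assumes "m > 0" "set ts \<subseteq> set ns"
  shows "mean m ns (mean m ts F) = mean m ns F"
  using assms(2) by (induction ts) (simp_all add: mean_absorb1[OF assms(1)])

text \<open>Averaging is an orthogonal projection: by the tower and pull-out properties the cross
  term has the same mean as the square of the projection.\<close>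

lemma mean_pythagoras:
  assumes "m > 0" "set ts \<subseteq> set ns"
  shows "mean m ns (\<lambda>x. (G x - mean m ts G x)\<^sup>2) x
    = mean m ns (\<lambda>x. (G x)\<^sup>2) x - mean m ns (\<lambda>x. (mean m ts G x)\<^sup>2) x"
proof -
  let ?A = "mean m ts G"
  have "mean m ns (\<lambda>x. ?A x * G x) = mean m ns (mean m ts (\<lambda>x. ?A x * G x))"
    by (rule mean_absorb[OF assms, symmetric])
  also have "mean m ts (\<lambda>x. ?A x * G x) = (\<lambda>x. ?A x * ?A x)"
    by (rule ext, rule mean_mult_invariant) (rule mean_upd_same)
  finally have cross: "mean m ns (\<lambda>x. ?A x * G x) x = mean m ns (\<lambda>x. (?A x)\<^sup>2) x"
    by (simp add: power2_eq_square)
  have "(\<lambda>x. (G x - ?A x)\<^sup>2) = (\<lambda>x. ((G x)\<^sup>2 - 2 * (?A x * G x)) + (?A x)\<^sup>2)"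
    by (simp add: power2_eq_square algebra_simps)
  then show ?thesis using cross by (simp add: mean_add mean_diff mean_cmult)
qed

lemma mean_power2_le:
  assumes "m > 0"
  shows "(mean m ns F x)\<^sup>2 \<le> mean m ns (\<lambda>x. (F x)\<^sup>2) x"
proof -
  let ?c = "mean m ns F x"
  have "0 \<le> mean m ns (\<lambda>x. (F x - ?c)\<^sup>2) x" by (rule mean_nonneg) simp
  also have "(\<lambda>x. (F x - ?c)\<^sup>2) = (\<lambda>x. ((F x)\<^sup>2 - 2 * ?c * F x) + ?c\<^sup>2)"
    by (simp add: power2_eq_square algebra_simps)
  finally show ?thesis
    by (simp add: mean_add mean_diff mean_cmult mean_const[OF assms] power2_eq_square)
qed

lemma fdiff_mean1_same: "fdiff n (mean1 m n F) = (\<lambda>_. 0)"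
  by (simp add: fdiff_def fun_eq_iff)

lemma fdiff_mean1_other:
  assumes "i \<noteq> n"
  shows "fdiff i (mean1 m n F) = mean1 m n (fdiff i F)"
  using assms
  by (simp add: fdiff_def mean1_def fun_eq_iff fun_upd_twist sum_subtractf diff_divide_distrib)

section \<open>A logarithmic Sobolev inequality\<close>

text \<open>Oscillation is at most total variation. Stopping at \<open>m - 1\<close> involves only
  values \<open>h k\<close> with \<open>k < m\<close>.\<close>

lemma sum_telescope_abs:
  fixes h :: "nat \<Rightarrow> real"
  assumes "j < m" "k < m"
  shows "\<bar>h j - h k\<bar> \<le> (\<Sum>i<m - 1. \<bar>h (Suc i) - h i\<bar>)"
proof -
  have le: "\<bar>h b - h a\<bar> \<le> (\<Sum>i<m - 1. \<bar>h (Suc i) - h i\<bar>)" if "a \<le> b" "b < m" for a b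
  proof -
    have "\<bar>h b - h a\<bar> = \<bar>\<Sum>i=a..<b. h (Suc i) - h i\<bar>"
      using that by (simp add: sum_Suc_diff')
    also have "\<dots> \<le> (\<Sum>i=a..<b. \<bar>h (Suc i) - h i\<bar>)" by (rule sum_abs)
    also have "\<dots> \<le> (\<Sum>i<m - 1. \<bar>h (Suc i) - h i\<bar>)"
      using that by (intro sum_mono2) auto
    finally show ?thesis .
  qed
  show ?thesis
    using le[of j k] le[of k j] assms by (cases "j \<le> k") (auto simp: abs_minus_commute)
qed

text \<open>The entropy of the square of \<open>g\<close> is at most its variance over its mean; the
  variance is at most the squared total variation, which Cauchy-Schwarz bounds by the energy. The
  step from \<open>m - 1\<close> to \<open>m\<close> on the right leaves the window but only adds a
  nonnegative term.\<close>

lemma log_sobolev_path: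
  fixes g :: "nat \<Rightarrow> real"
  assumes m: "m > 0"
  defines "b \<equiv> (\<Sum>k<m. (g k)\<^sup>2) / real m"
  shows "(\<Sum>k<m. (g k)\<^sup>2 * ln ((g k)\<^sup>2)) / real m - b * ln b
    \<le> 4 * (real m)\<^sup>2 * ((\<Sum>k<m. (g (Suc k) - g k)\<^sup>2) / real m)"
proof (cases "b = 0")
  case True
  then have "\<forall>k\<in>{..<m}. (g k)\<^sup>2 = 0"
    using m unfolding b_def by (simp add: sum_nonneg_eq_0_iff)
  then have "(\<Sum>k<m. (g k)\<^sup>2 * ln ((g k)\<^sup>2)) = 0" by (intro sum.neutral) auto
  then show ?thesis using True by (simp add: sum_nonneg)
next
  case False
  define h where "h k = (g k)\<^sup>2" for k
  define W where "W = (\<Sum>i<m - 1. \<bar>h (Suc i) - h i\<bar>)"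
  define A where "A = (\<Sum>k<m. (g (Suc k) - g k)\<^sup>2)"
  have mb: "(\<Sum>k<m. h k) = m * b" using m by (simp add: b_def h_def)
  have "b \<ge> 0" by (simp add: b_def sum_nonneg)
  then have b: "b > 0" using False by simp
  have W0: "W \<ge> 0" unfolding W_def by (rule sum_nonneg) simp
  have hb: "\<bar>h k - b\<bar> \<le> W" if "k < m" for k
  proof -
    have "m * (h k - b) = (\<Sum>j<m. h k - h j)" by (simp add: sum_subtractf mb algebra_simps)
    also have "\<bar>\<dots>\<bar> \<le> (\<Sum>j<m. W)"
      unfolding W_def by (intro order_trans[OF sum_abs] sum_mono sum_telescope_abs) (use that in auto)
    finally show ?thesis using m by (simp add: abs_mult)
  qed
  \<comment> \<open>Each increment of \<open>h\<close> factors into the difference and the sum of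
    neighbouring values of \<open>g\<close>.\<close>
  have "W\<^sup>2 = (\<Sum>i<m - 1. \<bar>g (Suc i) - g i\<bar> * \<bar>g (Suc i) + g i\<bar>)\<^sup>2"
    by (simp add: W_def h_def square_diff_square_factored power2_eq_square abs_mult mult.commute)
  also have "\<dots> \<le> (\<Sum>i<m - 1. \<bar>g (Suc i) - g i\<bar>\<^sup>2) * (\<Sum>i<m - 1. \<bar>g (Suc i) + g i\<bar>\<^sup>2)"
    by (rule Cauchy_Schwarz_ineq_sum)
  also have "\<dots> \<le> A * (4 * (m * b))"
  proof (rule mult_mono)
    show "(\<Sum>i<m - 1. \<bar>g (Suc i) - g i\<bar>\<^sup>2) \<le> A"
      unfolding A_def power2_abs by (rule sum_mono2) auto
    have "(\<Sum>i<m - 1. \<bar>g (Suc i) + g i\<bar>\<^sup>2) \<le> (\<Sum>i<m - 1. 2 * h (Suc i) + 2 * h i)"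
    proof (rule sum_mono)
      fix i
      have "0 \<le> (g (Suc i) - g i)\<^sup>2" by simp
      then show "\<bar>g (Suc i) + g i\<bar>\<^sup>2 \<le> 2 * h (Suc i) + 2 * h i"
        by (simp add: h_def power2_eq_square algebra_simps)
    qed
    also have "\<dots> = 2 * (\<Sum>i<m - 1. h (Suc i)) + 2 * (\<Sum>i<m - 1. h i)"
      by (simp add: sum.distrib sum_distrib_left)
    also have "(\<Sum>i<m - 1. h (Suc i)) = (\<Sum>i\<in>Suc ` {..<m - 1}. h i)"
      by (simp add: sum.reindex)
    also have "\<dots> \<le> (\<Sum>i<m. h i)" by (rule sum_mono2) (auto simp: h_def)
    also have "(\<Sum>i<m - 1. h i) \<le> (\<Sum>i<m. h i)" by (rule sum_mono2) (auto simp: h_def)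
    finally show "(\<Sum>i<m - 1. \<bar>g (Suc i) + g i\<bar>\<^sup>2) \<le> 4 * (m * b)" by (simp add: mb mult.commute)
  qed (auto simp: A_def intro!: sum_nonneg)
  finally have W: "W\<^sup>2 \<le> A * (4 * (m * b))" .
  \<comment> \<open>This is \<open>ln t \<le> t - 1\<close> at \<open>t = h k / b\<close>, with the
    square completed so that the remaining linear term sums to zero.\<close>
  have "h k * ln (h k) - h k * ln b \<le> (h k - b)\<^sup>2 / b + (h k - b)" for k
  proof (cases "h k = 0")
    case False
    then have pos: "h k > 0" by (simp add: h_def)
    have "ln (h k) - ln b = ln (h k / b)" using pos b by (simp add: ln_div)
    also have "\<dots> \<le> h k / b - 1" using pos b by (intro ln_le_minus_one) simp
    finally have "h k * (ln (h k) - ln b) \<le> h k * (h k / b - 1)"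
      using pos by (intro mult_left_mono) auto
    then show ?thesis using b by (simp add: power2_eq_square field_simps)
  qed (use b in \<open>simp add: power2_eq_square\<close>)
  then have "(\<Sum>k<m. h k * ln (h k) - h k * ln b) \<le> (\<Sum>k<m. (h k - b)\<^sup>2 / b + (h k - b))"
    by (rule sum_mono)
  also have "\<dots> = (\<Sum>k<m. (h k - b)\<^sup>2 / b)" by (simp add: sum.distrib sum_subtractf mb)
  also have "\<dots> \<le> (\<Sum>k<m. W\<^sup>2 / b)"
    using hb b by (intro sum_mono divide_right_mono) (auto simp: power2_le_iff_abs_le W0)
  also have "\<dots> \<le> (\<Sum>k<m. A * (4 * m * b) / b)"
    using W b by (intro sum_mono divide_right_mono) auto
  also have "\<dots> = 4 * m\<^sup>2 * A" using b by (simp add: power2_eq_square)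
  finally have "(\<Sum>k<m. h k * ln (h k)) - m * b * ln b \<le> 4 * m\<^sup>2 * A"
    by (simp add: sum_subtractf mb flip: sum_distrib_right)
  then have "((\<Sum>k<m. h k * ln (h k)) - m * b * ln b) / m \<le> 4 * m\<^sup>2 * A / m"
    by (rule divide_right_mono) simp
  then show ?thesis using m by (simp add: h_def A_def diff_divide_distrib)
qed

lemma log_sobolev_mean1:
  assumes "m > 0"
  shows "mean1 m n (\<lambda>x. (g x)\<^sup>2 * ln ((g x)\<^sup>2)) x
      - mean1 m n (\<lambda>x. (g x)\<^sup>2) x * ln (mean1 m n (\<lambda>x. (g x)\<^sup>2) x)
    \<le> 4 * (real m)\<^sup>2 * mean1 m n (\<lambda>x. (fdiff n g x)\<^sup>2) x"
  using log_sobolev_path[OF assms, of "\<lambda>k. g (x(n := k))"] by (simp add: mean1_def fdiff_def)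

text \<open>Reverse triangle inequality for the Euclidean norm along coordinate \<open>n\<close>. It
  allows \<open>g\<close> to be replaced by the root of its partial mean square without raising the
  energy in the other directions.\<close>

lemma fdiff_sqrt_mean1_le:
  assumes "i \<noteq> n"
  shows "(fdiff i (\<lambda>x. sqrt (mean1 m n (\<lambda>x. (g x)\<^sup>2) x)) x)\<^sup>2
    \<le> mean1 m n (\<lambda>x. (fdiff i g x)\<^sup>2) x"
proof -
  define y where "y = x(i := Suc (x i))"
  define u v where "u k = g (y(n := k))" and "v k = g (x(n := k))" for k
  let ?N = "\<lambda>f. L2_set f {..<m}"
  have tri: "\<bar>?N u - ?N v\<bar> \<le> ?N (\<lambda>k. u k - v k)"
    using L2_set_triangle_ineq[of "\<lambda>k. u k - v k" v "{..<m}"]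
      L2_set_triangle_ineq[of "\<lambda>k. v k - u k" u "{..<m}"]
    by (simp add: L2_set_def power2_commute abs_le_iff)
  have sq: "sqrt (mean1 m n (\<lambda>x. (g x)\<^sup>2) z) = ?N (\<lambda>k. g (z(n := k))) / sqrt m" for z
    by (simp add: mean1_def L2_set_def real_sqrt_divide)
  have "(fdiff i (\<lambda>x. sqrt (mean1 m n (\<lambda>x. (g x)\<^sup>2) x)) x)\<^sup>2 = \<bar>?N u - ?N v\<bar>\<^sup>2 / m"
    unfolding fdiff_def sq u_def v_def y_def diff_divide_distrib[symmetric] power_divide by simp
  also have "\<dots> \<le> (?N (\<lambda>k. u k - v k))\<^sup>2 / m"
    by (intro divide_right_mono power_mono tri) auto
  also have "\<dots> = mean1 m n (\<lambda>x. (fdiff i g x)\<^sup>2) x"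
    using assms by (simp add: L2_set_def sum_nonneg mean1_def fdiff_def u_def v_def y_def fun_upd_twist)
  finally show ?thesis .
qed

text \<open>Tensorization: the entropy over \<open>n # ns\<close> is the mean of the entropy in
  coordinate \<open>n\<close> plus the entropy over \<open>ns\<close> of the partial mean. Each part
  has its own inequality, so the constant does not depend on the number of coordinates.\<close>

theorem log_sobolev_mean:
  assumes m: "m > 0" and "distinct ns"
  shows "mean m ns (\<lambda>x. (g x)\<^sup>2 * ln ((g x)\<^sup>2)) x
      - mean m ns (\<lambda>x. (g x)\<^sup>2) x * ln (mean m ns (\<lambda>x. (g x)\<^sup>2) x)
    \<le> 4 * (real m)\<^sup>2 * (\<Sum>i\<in>set ns. mean m ns (\<lambda>x. (fdiff i g x)\<^sup>2) x)"
  using assms(2)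
proof (induction ns arbitrary: g)
  case (Cons n ns)
  let ?M = "mean m ns" and ?A = "mean1 m n" and ?c = "4 * (real m)\<^sup>2"
  define G where "G x = sqrt (?A (\<lambda>x. (g x)\<^sup>2) x)" for x
  have G2: "(G x)\<^sup>2 = ?A (\<lambda>x. (g x)\<^sup>2) x" for x
    by (simp add: G_def mean1_def sum_nonneg)
  \<comment> \<open>\<open>mean\<close> puts the head of the list outermost; this moves it
    innermost.\<close>
  have out: "?A (?M h) = ?M (?A h)" for h by (rule mean_mean1_commute[symmetric])
  have "?M (\<lambda>x. ?A (\<lambda>x. (g x)\<^sup>2 * ln ((g x)\<^sup>2)) x - (G x)\<^sup>2 * ln ((G x)\<^sup>2)) x
      \<le> ?M (\<lambda>x. ?c * ?A (\<lambda>x. (fdiff n g x)\<^sup>2) x) x"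
    unfolding G2 by (rule mean_mono) (rule log_sobolev_mean1[OF m])
  then have 1: "?M (?A (\<lambda>x. (g x)\<^sup>2 * ln ((g x)\<^sup>2))) x - ?M (\<lambda>x. (G x)\<^sup>2 * ln ((G x)\<^sup>2)) x
      \<le> ?c * ?M (?A (\<lambda>x. (fdiff n g x)\<^sup>2)) x"
    unfolding mean_diff mean_cmult .
  have "(\<Sum>i\<in>set ns. ?M (\<lambda>x. (fdiff i G x)\<^sup>2) x)
      \<le> (\<Sum>i\<in>set ns. ?M (?A (\<lambda>x. (fdiff i g x)\<^sup>2)) x)"
    using Cons.prems unfolding G_def
    by (intro sum_mono mean_mono fdiff_sqrt_mean1_le) auto
  then have 2: "?c * (\<Sum>i\<in>set ns. ?M (\<lambda>x. (fdiff i G x)\<^sup>2) x)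
      \<le> ?c * (\<Sum>i\<in>set ns. ?M (?A (\<lambda>x. (fdiff i g x)\<^sup>2)) x)"
    by (rule mult_left_mono) simp
  have 3: "?M (\<lambda>x. (G x)\<^sup>2 * ln ((G x)\<^sup>2)) x
      - ?M (\<lambda>x. (G x)\<^sup>2) x * ln (?M (\<lambda>x. (G x)\<^sup>2) x)
      \<le> ?c * (\<Sum>i\<in>set ns. ?M (\<lambda>x. (fdiff i G x)\<^sup>2) x)"
    using Cons by simp
  have G2': "?M (\<lambda>x. (G x)\<^sup>2) = ?M (?A (\<lambda>x. (g x)\<^sup>2))" by (simp add: G2)
  show ?case
    using 1 2 3 Cons.prems by (simp add: out G2' distrib_left)
qed simp

text \<open>Jensen's inequality for the logarithm under the weight \<open>(g x)\<^sup>2\<close>, in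
  the form of a tangent bound with a free scale \<open>l\<close>.\<close>

lemma entropy_ge:
  assumes m: "m > 0" and M: "M > 1"
    and b: "M * (mean m ns (\<lambda>x. \<bar>g x\<bar>) x)\<^sup>2 \<le> mean m ns (\<lambda>x. (g x)\<^sup>2) x"
  shows "ln M * mean m ns (\<lambda>x. (g x)\<^sup>2) x \<le> mean m ns (\<lambda>x. (g x)\<^sup>2 * ln ((g x)\<^sup>2)) x
      - mean m ns (\<lambda>x. (g x)\<^sup>2) x * ln (mean m ns (\<lambda>x. (g x)\<^sup>2) x)"
proof -
  define a where "a = mean m ns (\<lambda>x. \<bar>g x\<bar>) x"
  define b where "b = mean m ns (\<lambda>x. (g x)\<^sup>2) x"
  have a0: "a \<ge> 0" unfolding a_def by (rule mean_nonneg) simp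
  have b0: "b \<ge> 0" unfolding b_def by (rule mean_nonneg) simp
  have ineq: "2 * ln l * b - mean m ns (\<lambda>x. (g x)\<^sup>2 * ln ((g x)\<^sup>2)) x \<le> 2 * l * a - 2 * b"
    if l: "l > 0" for l
  proof -
    have "2 * ln l * (g x)\<^sup>2 - (g x)\<^sup>2 * ln ((g x)\<^sup>2) \<le> 2 * l * \<bar>g x\<bar> - 2 * (g x)\<^sup>2" for x
    proof (cases "g x = 0")
      case False
      then have g: "\<bar>g x\<bar> > 0" by simp
      have "ln ((g x)\<^sup>2) = 2 * ln \<bar>g x\<bar>"
        using ln_realpow[of "\<bar>g x\<bar>" 2] g by simp
      moreover have "ln l - ln \<bar>g x\<bar> \<le> l / \<bar>g x\<bar> - 1"
        using ln_le_minus_one[of "l / \<bar>g x\<bar>"] l g by (simp add: ln_div)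
      ultimately have "2 * \<bar>g x\<bar>\<^sup>2 * (ln l - ln ((g x)\<^sup>2) / 2) \<le> 2 * \<bar>g x\<bar>\<^sup>2 * (l / \<bar>g x\<bar> - 1)"
        by (intro mult_left_mono) auto
      also have "\<dots> = 2 * l * \<bar>g x\<bar> - 2 * \<bar>g x\<bar>\<^sup>2"
        using g by (simp add: power2_eq_square field_simps)
      finally show ?thesis by (simp add: algebra_simps)
    qed simp
    then have "mean m ns (\<lambda>x. 2 * ln l * (g x)\<^sup>2 - (g x)\<^sup>2 * ln ((g x)\<^sup>2)) x
        \<le> mean m ns (\<lambda>x. 2 * l * \<bar>g x\<bar> - 2 * (g x)\<^sup>2) x"
      by (rule mean_mono)
    then show ?thesis unfolding mean_diff mean_cmult a_def b_def .
  qed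
  show ?thesis
  proof (cases "b = 0")
    case True
    have "M * a\<^sup>2 \<le> 0" using b True by (simp add: a_def b_def)
    then have "a\<^sup>2 \<le> 0" using M by (simp add: mult_le_0_iff)
    then have "0 \<le> mean m ns (\<lambda>x. (g x)\<^sup>2 * ln ((g x)\<^sup>2)) x" using ineq[of 1] True by simp
    then show ?thesis using True by (simp add: b_def)
  next
    case False
    then have bpos: "b > 0" using b0 by simp
    have apos: "a > 0"
    proof (rule ccontr)
      assume "\<not> a > 0"
      then have "a = 0" using a0 by simp
      \<comment> \<open>With \<open>a = 0\<close> the right side of \<open>ineq\<close> is the
        constant \<open>- 2 * b\<close>, which a large scale violates.\<close>
      define l where "l = exp (\<bar>mean m ns (\<lambda>x. (g x)\<^sup>2 * ln ((g x)\<^sup>2)) x\<bar> / b)"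
      have "ln l * b = \<bar>mean m ns (\<lambda>x. (g x)\<^sup>2 * ln ((g x)\<^sup>2)) x\<bar>"
        using bpos by (simp add: l_def)
      with ineq[of l] \<open>a = 0\<close> bpos show False by (simp add: l_def)
    qed
    \<comment> \<open>The scale \<open>l = b / a\<close> makes the right side of \<open>ineq\<close>
      vanish.\<close>
    have "2 * (b / a) * a - 2 * b = 0" using apos by simp
    then have "2 * ln (b / a) * b \<le> mean m ns (\<lambda>x. (g x)\<^sup>2 * ln ((g x)\<^sup>2)) x"
      using ineq[of "b / a"] apos bpos by simp
    moreover have "ln M \<le> ln (b / a\<^sup>2)"
      using b apos bpos M unfolding a_def[symmetric] b_def[symmetric]
      by (intro ln_mono) (auto simp: field_simps)
    then have "ln M * b \<le> (2 * ln (b / a) - ln b) * b"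
      using apos bpos by (intro mult_right_mono) (auto simp: ln_div ln_realpow)
    ultimately show ?thesis by (simp add: b_def[symmetric] algebra_simps)
  qed
qed

section \<open>Functions with bounded total variation are close to juntas\<close>

lemma fdiff_minus: "fdiff i (\<lambda>x. F x - G x) = (\<lambda>x. fdiff i F x - fdiff i G x)"
  by (simp add: fdiff_def fun_eq_iff)

text \<open>A one-dimensional Poincare inequality: on each fibre the deviation from the mean is at
  most the total variation, which is \<open>m\<close> times the mean absolute difference.\<close>

lemma abs_diff_mean1_le:
  assumes m: "m > 0"
  shows "mean1 m n (\<lambda>x. \<bar>F x - mean1 m n F x\<bar>) x \<le> real m * mean1 m n (\<lambda>x. \<bar>fdiff n F x\<bar>) x"
proof -
  define f where "f k = F (x(n := k))" for k
  let ?V = "\<Sum>i<m. \<bar>f (Suc i) - f i\<bar>"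
  have "\<bar>f k - mean1 m n F x\<bar> \<le> ?V" if "k < m" for k
  proof -
    have "m * (f k - mean1 m n F x) = (\<Sum>j<m. f k - f j)"
      using m by (simp add: mean1_def f_def sum_subtractf algebra_simps)
    also have "\<bar>\<dots>\<bar> \<le> (\<Sum>j<m. ?V)"
    proof (intro order_trans[OF sum_abs] sum_mono)
      fix j assume "j \<in> {..<m}"
      then have "\<bar>f k - f j\<bar> \<le> (\<Sum>i<m - 1. \<bar>f (Suc i) - f i\<bar>)"
        using that by (intro sum_telescope_abs) auto
      also have "\<dots> \<le> ?V" by (rule sum_mono2) auto
      finally show "\<bar>f k - f j\<bar> \<le> ?V" .
    qed
    finally show ?thesis using m by (simp add: abs_mult)
  qed
  then have "(\<Sum>k<m. \<bar>f k - mean1 m n F x\<bar>) \<le> (\<Sum>k<m. ?V)"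
    by (intro sum_mono) auto
  then show ?thesis using m by (simp add: mean1_def[of _ _ "\<lambda>x. \<bar>_ x\<bar>"] fdiff_def f_def field_simps)
qed

text \<open>Dichotomy at the ratio \<open>M\<close> of mean square to squared mean absolute value:
  above it large entropy and the logarithmic Sobolev inequality give the first term, below it the
  second term suffices. Adding both gives one bound that can be summed over martingale
  increments.\<close>

lemma mean_power2_le_add_energy:
  assumes m: "m > 0" and M: "M > 1" and "distinct ns"
  shows "mean m ns (\<lambda>x. (g x)\<^sup>2) x
    \<le> 4 * (real m)\<^sup>2 / ln M * (\<Sum>i\<in>set ns. mean m ns (\<lambda>x. (fdiff i g x)\<^sup>2) x)
      + M * (mean m ns (\<lambda>x. \<bar>g x\<bar>) x)\<^sup>2"
proof (cases "M * (mean m ns (\<lambda>x. \<bar>g x\<bar>) x)\<^sup>2 \<le> mean m ns (\<lambda>x. (g x)\<^sup>2) x")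
  case True
  have "ln M * mean m ns (\<lambda>x. (g x)\<^sup>2) x
      \<le> 4 * (real m)\<^sup>2 * (\<Sum>i\<in>set ns. mean m ns (\<lambda>x. (fdiff i g x)\<^sup>2) x)"
    using entropy_ge[OF m M True] log_sobolev_mean[OF m assms(3), of g x] by linarith
  then have "mean m ns (\<lambda>x. (g x)\<^sup>2) x
      \<le> 4 * (real m)\<^sup>2 / ln M * (\<Sum>i\<in>set ns. mean m ns (\<lambda>x. (fdiff i g x)\<^sup>2) x)"
    using M by (simp add: field_simps)
  moreover have "0 \<le> M * (mean m ns (\<lambda>x. \<bar>g x\<bar>) x)\<^sup>2" using M by simp
  ultimately show ?thesis by linarith
next
  case False
  have "0 \<le> 4 * (real m)\<^sup>2 / ln M * (\<Sum>i\<in>set ns. mean m ns (\<lambda>x. (fdiff i g x)\<^sup>2) x)"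
    using M by (intro mult_nonneg_nonneg sum_nonneg mean_nonneg) auto
  with False show ?thesis by linarith
qed

text \<open>Decomposing along the martingale obtained by averaging over one coordinate at a time,
  the entropies of the increments are controlled by a single telescoping energy
  (Falik and Samorodnitsky).\<close>

lemma mean_variance_le:
  assumes m: "m > 0" and M: "M > 1" and ns: "distinct ns"
    and "set ts \<subseteq> set ns"
  shows "mean m ns (\<lambda>x. (F x)\<^sup>2) x - mean m ns (\<lambda>x. (mean m ts F x)\<^sup>2) x
    \<le> 4 * (real m)\<^sup>2 / ln M * (\<Sum>i\<in>set ns. mean m ns (\<lambda>x. (fdiff i F x)\<^sup>2) x
          - mean m ns (\<lambda>x. (fdiff i (mean m ts F) x)\<^sup>2) x)
      + M * (\<Sum>t\<leftarrow>ts. (real m * mean m ns (\<lambda>x. \<bar>fdiff t F x\<bar>) x)\<^sup>2)"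
  using assms(4)
proof (induction ts)
  case (Cons t ts)
  let ?E = "\<lambda>h. mean m ns h x" and ?A = "mean1 m t" and ?c = "4 * (real m)\<^sup>2 / ln M"
  define G where "G = mean m ts F"
  define d where "d = (\<lambda>y. G y - ?A G y)"
  have t: "t \<in> set ns" and t': "set [t] \<subseteq> set ns" using Cons.prems by auto
  have pyth: "?E (\<lambda>y. (H y - ?A H y)\<^sup>2) = ?E (\<lambda>y. (H y)\<^sup>2) - ?E (\<lambda>y. (?A H y)\<^sup>2)" for H
    using mean_pythagoras[OF m t', of H x] by simp
  \<comment> \<open>The energy of \<open>d\<close> is the energy lost by averaging \<open>G\<close>:
    differences in other directions commute with the average, so Pythagoras applies to them, and the
    average has zero difference in direction \<open>t\<close>.\<close>
  have energy: "?E (\<lambda>y. (fdiff i d y)\<^sup>2)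
      = ?E (\<lambda>y. (fdiff i G y)\<^sup>2) - ?E (\<lambda>y. (fdiff i (?A G) y)\<^sup>2)" for i
  proof (cases "i = t")
    case True
    then show ?thesis by (simp add: d_def fdiff_minus fdiff_mean1_same mean_const[OF m])
  next
    case False
    then show ?thesis by (simp add: d_def fdiff_minus fdiff_mean1_other pyth)
  qed
  \<comment> \<open>Since \<open>d\<close> is itself an average of \<open>F - ?A F\<close>, its
    \<open>L\<^sub>1\<close>-norm is bounded by the influence of \<open>t\<close> on the original
    \<open>F\<close>.\<close>
  have "d y = mean m ts (\<lambda>y. F y - ?A F y) y" for y
    by (simp add: d_def G_def mean_diff mean_mean1_commute)
  then have "?E (\<lambda>y. \<bar>d y\<bar>) \<le> ?E (mean m ts (\<lambda>y. \<bar>F y - ?A F y\<bar>))"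
    by (auto intro!: mean_mono abs_mean_le)
  also have "\<dots> = ?E (?A (\<lambda>y. \<bar>F y - ?A F y\<bar>))"
    using Cons.prems by (simp add: mean_absorb[OF m] mean_absorb1[OF m])
  also have "\<dots> \<le> ?E (\<lambda>y. real m * ?A (\<lambda>y. \<bar>fdiff t F y\<bar>) y)"
    by (rule mean_mono) (rule abs_diff_mean1_le[OF m])
  also have "\<dots> = real m * ?E (\<lambda>y. \<bar>fdiff t F y\<bar>)"
    by (simp add: mean_cmult mean_absorb1[OF m t])
  finally have L1: "?E (\<lambda>y. \<bar>d y\<bar>) \<le> real m * ?E (\<lambda>y. \<bar>fdiff t F y\<bar>)" .
  have "0 \<le> ?E (\<lambda>y. \<bar>d y\<bar>)" by (rule mean_nonneg) simp
  then have "M * (?E (\<lambda>y. \<bar>d y\<bar>))\<^sup>2 \<le> M * (real m * ?E (\<lambda>y. \<bar>fdiff t F y\<bar>))\<^sup>2"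
    using L1 M by (intro mult_left_mono power_mono) auto
  with mean_power2_le_add_energy[OF m M ns, of d x]
  have step: "?E (\<lambda>y. (d y)\<^sup>2) \<le> ?c * (\<Sum>i\<in>set ns. ?E (\<lambda>y. (fdiff i d y)\<^sup>2))
      + M * (real m * ?E (\<lambda>y. \<bar>fdiff t F y\<bar>))\<^sup>2"
    by linarith
  have IH: "?E (\<lambda>y. (F y)\<^sup>2) - ?E (\<lambda>y. (G y)\<^sup>2)
    \<le> ?c * (\<Sum>i\<in>set ns. ?E (\<lambda>y. (fdiff i F y)\<^sup>2) - ?E (\<lambda>y. (fdiff i G y)\<^sup>2))
      + M * (\<Sum>t\<leftarrow>ts. (real m * ?E (\<lambda>y. \<bar>fdiff t F y\<bar>))\<^sup>2)"
    unfolding G_def using Cons by simp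
  have "?E (\<lambda>y. (F y)\<^sup>2) - ?E (\<lambda>y. (?A G y)\<^sup>2)
      = (?E (\<lambda>y. (F y)\<^sup>2) - ?E (\<lambda>y. (G y)\<^sup>2)) + ?E (\<lambda>y. (d y)\<^sup>2)"
    by (simp add: d_def pyth)
  also have "\<dots> \<le> ?c * (\<Sum>i\<in>set ns. ?E (\<lambda>y. (fdiff i F y)\<^sup>2) - ?E (\<lambda>y. (fdiff i G y)\<^sup>2))
      + M * (\<Sum>t\<leftarrow>ts. (real m * ?E (\<lambda>y. \<bar>fdiff t F y\<bar>))\<^sup>2)
      + (?c * (\<Sum>i\<in>set ns. ?E (\<lambda>y. (fdiff i d y)\<^sup>2))
      + M * (real m * ?E (\<lambda>y. \<bar>fdiff t F y\<bar>))\<^sup>2)"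
    by (rule add_mono[OF IH step])
  \<comment> \<open>The energies of \<open>G\<close> cancel, so the sum telescopes.\<close>
  also have "\<dots> = ?c * (\<Sum>i\<in>set ns. ?E (\<lambda>y. (fdiff i F y)\<^sup>2) - ?E (\<lambda>y. (fdiff i (?A G) y)\<^sup>2))
      + M * (\<Sum>t\<leftarrow>t # ts. (real m * ?E (\<lambda>y. \<bar>fdiff t F y\<bar>))\<^sup>2)"
    unfolding energy by (simp add: sum_subtractf algebra_simps)
  finally show ?case by (simp add: G_def)
qed simp

text \<open>The coordinates of influence below \<open>\<delta>\<close> are averaged out. The
  influences sum to at most \<open>C\<close>, which limits the number of the others, and the
  variance bound controls the error.\<close>

theorem mean_junta:
  assumes m: "m > 0" and M: "M > 1" and \<delta>: "(\<delta> :: real) > 0" and ns: "distinct ns"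
    and TV: "\<And>x. (\<Sum>i\<in>set ns. \<bar>fdiff i F x\<bar>) \<le> C / real m"
  shows "\<exists>ts. distinct ts \<and> set ts \<subseteq> set ns \<and> \<delta> * card (set ns - set ts) \<le> C
    \<and> (mean m ns (\<lambda>y. \<bar>F y - mean m ts F y\<bar>) x)\<^sup>2 \<le> 4 * C\<^sup>2 / ln M + M * \<delta> * C"
proof -
  let ?E = "\<lambda>h. mean m ns h x"
  define I where "I t = real m * ?E (\<lambda>y. \<bar>fdiff t F y\<bar>)" for t
  define ts where "ts = filter (\<lambda>t. I t < \<delta>) ns"
  have I0: "I t \<ge> 0" for t
    unfolding I_def by (intro mult_nonneg_nonneg mean_nonneg) auto
  have "(\<Sum>i\<in>set ns. ?E (\<lambda>y. \<bar>fdiff i F y\<bar>)) = ?E (\<lambda>y. \<Sum>i\<in>set ns. \<bar>fdiff i F y\<bar>)"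
    by (simp add: mean_sum)
  also have "\<dots> \<le> ?E (\<lambda>_. C / m)" by (rule mean_mono) (rule TV)
  also have "\<dots> = C / m" by (rule mean_const[OF m])
  finally have sumI: "(\<Sum>i\<in>set ns. I i) \<le> C"
    using m by (simp add: I_def field_simps flip: sum_distrib_left)
  have sub: "set ts \<subseteq> set ns" and dts: "distinct ts" using ns by (auto simp: ts_def)
  have "\<delta> * real (card (set ns - set ts)) = (\<Sum>i\<in>set ns - set ts. \<delta>)" by simp
  also have "\<dots> \<le> (\<Sum>i\<in>set ns - set ts. I i)" by (rule sum_mono) (auto simp: ts_def)
  also have "\<dots> \<le> (\<Sum>i\<in>set ns. I i)" by (rule sum_mono2) (auto simp: I0)
  finally have card: "\<delta> * card (set ns - set ts) \<le> C" using sumI by linarith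
  \<comment> \<open>A sum of squares is at most the square of the sum of absolute values, so the
    energy is bounded independently of the number of coordinates.\<close>
  have "(\<Sum>i\<in>set ns. (fdiff i F y)\<^sup>2) \<le> (C / m)\<^sup>2" for y
  proof -
    let ?s = "\<Sum>i\<in>set ns. \<bar>fdiff i F y\<bar>"
    have "(\<Sum>i\<in>set ns. (fdiff i F y)\<^sup>2) \<le> (\<Sum>i\<in>set ns. \<bar>fdiff i F y\<bar> * ?s)"
    proof (rule sum_mono)
      fix i assume "i \<in> set ns"
      then have "\<bar>fdiff i F y\<bar> \<le> ?s" by (intro member_le_sum) auto
      then have "\<bar>fdiff i F y\<bar> * \<bar>fdiff i F y\<bar> \<le> \<bar>fdiff i F y\<bar> * ?s" by (rule mult_left_mono) simp
      then show "(fdiff i F y)\<^sup>2 \<le> \<bar>fdiff i F y\<bar> * ?s" by (simp add: power2_eq_square)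
    qed
    also have "\<dots> = ?s\<^sup>2" by (simp add: power2_eq_square sum_distrib_right)
    also have "\<dots> \<le> (C / m)\<^sup>2" by (rule power_mono[OF TV]) (simp add: sum_nonneg)
    finally show ?thesis .
  qed
  then have "?E (\<lambda>y. \<Sum>i\<in>set ns. (fdiff i F y)\<^sup>2) \<le> ?E (\<lambda>_. (C / m)\<^sup>2)" by (rule mean_mono)
  then have "(\<Sum>i\<in>set ns. ?E (\<lambda>y. (fdiff i F y)\<^sup>2)) \<le> (C / m)\<^sup>2"
    by (simp add: mean_sum mean_const[OF m])
  moreover have "0 \<le> (\<Sum>i\<in>set ns. ?E (\<lambda>y. (fdiff i (mean m ts F) y)\<^sup>2))"
    by (intro sum_nonneg mean_nonneg) simp
  ultimately have "(\<Sum>i\<in>set ns. ?E (\<lambda>y. (fdiff i F y)\<^sup>2) - ?E (\<lambda>y. (fdiff i (mean m ts F) y)\<^sup>2))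
      \<le> (C / m)\<^sup>2"
    by (simp add: sum_subtractf)
  then have "4 * (real m)\<^sup>2 / ln M * (\<Sum>i\<in>set ns. ?E (\<lambda>y. (fdiff i F y)\<^sup>2)
      - ?E (\<lambda>y. (fdiff i (mean m ts F) y)\<^sup>2)) \<le> 4 * (real m)\<^sup>2 / ln M * (C / m)\<^sup>2"
    using M by (intro mult_left_mono) auto
  also have "\<dots> = 4 * C\<^sup>2 / ln M" using m by (simp add: power_divide)
  finally have 1: "4 * (real m)\<^sup>2 / ln M * (\<Sum>i\<in>set ns. ?E (\<lambda>y. (fdiff i F y)\<^sup>2)
      - ?E (\<lambda>y. (fdiff i (mean m ts F) y)\<^sup>2)) \<le> 4 * C\<^sup>2 / ln M" .
  \<comment> \<open>Influences in \<open>ts\<close> are below \<open>\<delta>\<close>, which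
    replaces one factor of each square.\<close>
  have "(\<Sum>t\<leftarrow>ts. (I t)\<^sup>2) = (\<Sum>t\<in>set ts. (I t)\<^sup>2)"
    using dts by (simp add: sum_list_distinct_conv_sum_set)
  also have "\<dots> \<le> (\<Sum>t\<in>set ts. \<delta> * I t)"
    using I0 by (intro sum_mono) (auto simp: ts_def power2_eq_square intro!: mult_right_mono)
  also have "\<dots> \<le> \<delta> * (\<Sum>t\<in>set ns. I t)"
    unfolding sum_distrib_left using sub \<delta> I0 by (intro sum_mono2) auto
  also have "\<dots> \<le> \<delta> * C" using sumI \<delta> by (intro mult_left_mono) auto
  finally have 2: "M * (\<Sum>t\<leftarrow>ts. (I t)\<^sup>2) \<le> M * \<delta> * C" using M by simp
  have "(?E (\<lambda>y. \<bar>F y - mean m ts F y\<bar>))\<^sup>2 \<le> ?E (\<lambda>y. (F y - mean m ts F y)\<^sup>2)"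
    using mean_power2_le[OF m, of ns "\<lambda>y. \<bar>F y - mean m ts F y\<bar>" x] by simp
  also have "\<dots> = ?E (\<lambda>y. (F y)\<^sup>2) - ?E (\<lambda>y. (mean m ts F y)\<^sup>2)"
    by (rule mean_pythagoras[OF m sub])
  also have "\<dots> \<le> 4 * C\<^sup>2 / ln M + M * \<delta> * C"
    using mean_variance_le[OF m M ns sub, of F x] 1 2 by (simp add: I_def)
  finally show ?thesis using dts sub card by blast
qed

section \<open>Smoothing\<close>

text \<open>In the maximum metric a simultaneous step in all coordinates of \<open>B\<close> is no
  longer than a step in a single one.\<close>

definition bump :: "'i set \<Rightarrow> ('i \<Rightarrow> nat) \<Rightarrow> 'i \<Rightarrow> nat" where
  "bump B x i = (if i \<in> B then Suc (x i) else x i)"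

lemma bump_empty [simp]: "bump {} x = x"
  by (simp add: bump_def fun_eq_iff)

text \<open>Raising the coordinates of \<open>A\<close> one by one, the increments telescope to
  \<open>G (bump A x) - G x\<close>; each is a difference at a bumped point, and moving it back to
  \<open>x\<close> costs \<open>c\<close>.\<close>

lemma sum_fdiff_le_bump:
  fixes G :: "('i \<Rightarrow> nat) \<Rightarrow> real"
  assumes "finite A" and "\<And>i B. i \<in> A \<Longrightarrow> B \<subseteq> A \<Longrightarrow> fdiff i G x \<le> fdiff i G (bump B x) + c"
  shows "(\<Sum>i\<in>A. fdiff i G x) \<le> G (bump A x) - G x + real (card A) * c"
  using assms
proof (induction A rule: finite_induct)
  case (insert n A)
  have "(bump A x)(n := Suc (bump A x n)) = bump (insert n A) x"
    using insert.hyps by (auto simp: bump_def fun_eq_iff)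
  then have "fdiff n G (bump A x) = G (bump (insert n A) x) - G (bump A x)"
    by (simp add: fdiff_def)
  moreover have "fdiff n G x \<le> fdiff n G (bump A x) + c" by (rule insert.prems) auto
  moreover have "(\<Sum>i\<in>A. fdiff i G x) \<le> G (bump A x) - G x + real (card A) * c"
    by (rule insert.IH) (rule insert.prems, auto)
  ultimately show ?case using insert.hyps by (simp add: algebra_simps)
qed simp

text \<open>The coordinates are split by the sign of their difference and each class is bumped at
  once, the negative class with \<open>- G\<close>. The two bumps account for
  \<open>2 * a\<close>.\<close>

lemma sum_abs_fdiff_le:
  fixes G :: "('i \<Rightarrow> nat) \<Rightarrow> real"
  assumes "finite I"
    and lip: "\<And>B x. B \<subseteq> I \<Longrightarrow> \<bar>G (bump B x) - G x\<bar> \<le> a"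
    and lip2: "\<And>i B x. i \<in> I \<Longrightarrow> B \<subseteq> I \<Longrightarrow> \<bar>fdiff i G (bump B x) - fdiff i G x\<bar> \<le> c"
  shows "(\<Sum>i\<in>I. \<bar>fdiff i G x\<bar>) \<le> 2 * a + real (card I) * c"
proof -
  define A where "A = {i \<in> I. fdiff i G x \<ge> 0}"
  have A: "A \<subseteq> I" "finite A" "finite (I - A)" using assms(1) by (auto simp: A_def)
  have "(\<Sum>i\<in>A. fdiff i G x) \<le> G (bump A x) - G x + real (card A) * c"
    by (rule sum_fdiff_le_bump[OF A(2)]) (use lip2 A in \<open>smt (verit) subset_iff\<close>)
  moreover have "(\<Sum>i\<in>I - A. fdiff i (\<lambda>x. - G x) x)
      \<le> - G (bump (I - A) x) - - G x + real (card (I - A)) * c"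
  proof (rule sum_fdiff_le_bump[OF A(3)])
    fix i B assume "i \<in> I - A" "B \<subseteq> I - A"
    then have "\<bar>fdiff i G (bump B x) - fdiff i G x\<bar> \<le> c" by (intro lip2) auto
    then show "fdiff i (\<lambda>x. - G x) x \<le> fdiff i (\<lambda>x. - G x) (bump B x) + c"
      by (simp add: fdiff_def)
  qed
  moreover have "(\<Sum>i\<in>I. \<bar>fdiff i G x\<bar>) = (\<Sum>i\<in>A. \<bar>fdiff i G x\<bar>) + (\<Sum>i\<in>I - A. \<bar>fdiff i G x\<bar>)"
    using sum.subset_diff[OF A(1) assms(1), of "\<lambda>i. \<bar>fdiff i G x\<bar>"] by simp
  moreover have "(\<Sum>i\<in>A. \<bar>fdiff i G x\<bar>) = (\<Sum>i\<in>A. fdiff i G x)"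
    by (rule sum.cong) (auto simp: A_def)
  moreover have "(\<Sum>i\<in>I - A. \<bar>fdiff i G x\<bar>) = (\<Sum>i\<in>I - A. fdiff i (\<lambda>x. - G x) x)"
    by (rule sum.cong) (auto simp: A_def fdiff_def)
  moreover have "card I = card A + card (I - A)"
    using card_Un_disjoint[OF A(2,3)] A(1) by (simp add: Un_absorb1)
  then have "real (card I) * c = real (card A) * c + real (card (I - A)) * c"
    by (metis distrib_right of_nat_add)
  moreover have "\<bar>G (bump A x) - G x\<bar> \<le> a" "\<bar>G (bump (I - A) x) - G x\<bar> \<le> a"
    using lip A by auto
  ultimately show ?thesis by linarith
qed

text \<open>A sliding average over the box of side \<open>L\<close> with lowest corner
  \<open>x\<close>; the base point zero leaves coordinates outside \<open>ns\<close>
  unshifted.\<close>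

definition smooth :: "nat \<Rightarrow> 'i list \<Rightarrow> (('i \<Rightarrow> nat) \<Rightarrow> real) \<Rightarrow> ('i \<Rightarrow> nat) \<Rightarrow> real" where
  "smooth L ns F x = mean L ns (\<lambda>u. F (\<lambda>i. x i + u i)) (\<lambda>_. 0)"

text \<open>A step in \<open>x\<close> can be carried out in the shift \<open>u\<close>; inserting a
  further average over coordinate \<open>n\<close> then telescopes to the two opposite faces of the
  box.\<close>

lemma fdiff_smooth:
  assumes L: "L > 0" and n: "n \<in> set ns"
  shows "fdiff n (smooth L ns F) x
    = mean L ns (\<lambda>u. F (\<lambda>i. x i + (u(n := L)) i) - F (\<lambda>i. x i + (u(n := 0)) i)) (\<lambda>_. 0) / L"
proof -
  let ?H = "\<lambda>u. F (\<lambda>i. x i + u i)"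
  have "(\<lambda>i. (x(n := Suc (x n))) i + u i) = (\<lambda>i. x i + (u(n := Suc (u n))) i)" for u
    by (auto simp: fun_eq_iff)
  then have "fdiff n (smooth L ns F) x = mean L ns (fdiff n ?H) (\<lambda>_. 0)"
    unfolding fdiff_def smooth_def mean_diff by presburger
  also have "\<dots> = mean L ns (mean1 L n (fdiff n ?H)) (\<lambda>_. 0)"
    using mean_absorb1[OF L n] by metis
  also have "mean1 L n (fdiff n ?H) = (\<lambda>u. (?H (u(n := L)) - ?H (u(n := 0))) / L)"
  proof
    fix u
    have "(\<Sum>k<L. ?H (u(n := Suc k)) - ?H (u(n := k))) = ?H (u(n := L)) - ?H (u(n := 0))"
      by (rule sum_lessThan_telescope)
    then show "mean1 L n (fdiff n ?H) u = (?H (u(n := L)) - ?H (u(n := 0))) / L"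
      unfolding mean1_def fdiff_def by (simp only: fun_upd_same fun_upd_upd)
  qed
  finally show ?thesis unfolding mean_divide .
qed

text \<open>After averaging over a box of side \<open>L\<close>, each partial difference is itself
  \<open>O(1 / L)\<close>-close to constant on unit boxes, which rules out oscillation at the grid scale.\<close>

lemma sum_abs_fdiff_smooth_le:
  assumes L: "L > 0"
    and lip: "\<And>B x. B \<subseteq> set ns \<Longrightarrow> \<bar>F (bump B x) - F x\<bar> \<le> a"
  shows "(\<Sum>i\<in>set ns. \<bar>fdiff i (smooth L ns F) x\<bar>) \<le> 2 * a + real (card (set ns)) * (2 * a / L)"
proof (rule sum_abs_fdiff_le)
  have shift: "(\<lambda>i. bump B y i + u i) = bump B (\<lambda>i. y i + u i)" for B :: "'a set" and y u
    by (auto simp: bump_def fun_eq_iff)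
  show "\<bar>smooth L ns F (bump B y) - smooth L ns F y\<bar> \<le> a" if "B \<subseteq> set ns" for B y
    unfolding smooth_def shift mean_diff[symmetric]
    by (rule abs_mean_le_bound[OF L]) (rule lip[OF that])
  show "\<bar>fdiff i (smooth L ns F) (bump B y) - fdiff i (smooth L ns F) y\<bar> \<le> 2 * a / L"
    if "i \<in> set ns" "B \<subseteq> set ns" for i B y
  proof -
    \<comment> \<open>Interchanging the bump with the difference across the faces leaves two bump
      increments, each at most \<open>a\<close>.\<close>
    let ?D = "\<lambda>v. F (bump B v) - F v"
    have "\<bar>mean L ns (\<lambda>u. ?D (\<lambda>j. y j + (u(i := L)) j) - ?D (\<lambda>j. y j + (u(i := 0)) j)) (\<lambda>_. 0)\<bar>
        \<le> 2 * a"
    proof (rule abs_mean_le_bound[OF L])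
      fix u :: "'a \<Rightarrow> nat"
      show "\<bar>?D (\<lambda>j. y j + (u(i := L)) j) - ?D (\<lambda>j. y j + (u(i := 0)) j)\<bar> \<le> 2 * a"
        using lip[OF that(2), of "\<lambda>j. y j + (u(i := L)) j"]
          lip[OF that(2), of "\<lambda>j. y j + (u(i := 0)) j"] by linarith
    qed
    then show ?thesis
      unfolding fdiff_smooth[OF L that(1)] shift diff_divide_distrib[symmetric]
        mean_diff[symmetric]
      using L by (simp add: abs_divide divide_right_mono algebra_simps)
  qed
qed simp

section \<open>Comparing the torus with the grid\<close>

text \<open>\<open>restrict\<close> makes the result extensional, hence a point of the torus over
  \<open>I\<close>.\<close>

definition grid :: "nat \<Rightarrow> nat set \<Rightarrow> (nat \<Rightarrow> nat) \<Rightarrow> nat \<Rightarrow> circle" where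
  "grid m I w = restrict (\<lambda>n. to_circle (real (w n) / real m)) I"

lemma (in prob_space) abs_integral_le_const:
  fixes g :: "'a \<Rightarrow> real"
  assumes "integrable M g" "\<And>x. x \<in> space M \<Longrightarrow> \<bar>g x\<bar> \<le> c"
  shows "\<bar>\<integral>x. g x \<partial>M\<bar> \<le> c"
proof -
  have "\<bar>\<integral>x. g x \<partial>M\<bar> \<le> (\<integral>x. \<bar>g x\<bar> \<partial>M)" by (rule integral_abs_bound)
  also have "\<dots> \<le> c" using assms by (intro integral_le_const) auto
  finally show ?thesis .
qed

text \<open>The Riemann sum is the integral of the step function \<open>s\<close> that takes on each
  cell of length \<open>1 / m\<close> the value of \<open>g\<close> at the left endpoint.\<close>

lemma circle_quadrature:
  assumes m: "m > 0" and g [measurable]: "g \<in> borel_measurable borel"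
    and B: "\<And>a. \<bar>g a\<bar> \<le> B" and lip: "\<And>a b. \<bar>g a - g b\<bar> \<le> K * dist a b" and K: "K \<ge> 0"
  shows "\<bar>(\<integral>a. g a \<partial>haar) - (\<Sum>k<m. g (to_circle (real k / real m))) / real m\<bar> \<le> K / real m"
proof -
  let ?M = "restrict_space lborel {0..<1::real}"
  let ?J = "\<lambda>k. {real k / real m..<(real k + 1) / real m}"
  interpret M: prob_space ?M by (rule prob_space_restrict_space) auto
  define s where "s t = (\<Sum>k<m. g (to_circle (real k / real m)) * indicator (?J k) t)" for t :: real
  have c [measurable]: "to_circle \<in> ?M \<rightarrow>\<^sub>M borel" by (rule measurable_restrict_space1) simp
  have gi: "integrable ?M (\<lambda>t. g (to_circle t))"
    by (rule M.integrable_const_bound[where B = B]) (use B in auto)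
  have J: "?J k \<subseteq> {0..<1}" if "k < m" for k
    using that m by (auto simp: field_simps)
  have sJ: "?J k \<in> sets ?M" if "k < m" for k
    using J[OF that] by (subst sets_restrict_space_iff) auto
  have mJ: "measure ?M (?J k) = 1 / m" if "k < m" for k
    using J[OF that] m
    by (subst measure_restrict_space) (auto simp: divide_right_mono add_divide_distrib)
  have indi: "integrable ?M (indicator (?J k) :: real \<Rightarrow> real)" if "k < m" for k
    using sJ[OF that] by (intro integrable_real_indicator) (simp_all add: M.emeasure_eq_measure)
  have si: "integrable ?M s" unfolding s_def
    by (intro Bochner_Integration.integrable_sum integrable_mult_right indi) simp
  have "(\<integral>t. s t \<partial>?M) = (\<Sum>k<m. g (to_circle (real k / real m)) * (1 / m))"
  proof -
    have "(\<integral>t. s t \<partial>?M)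
        = (\<Sum>k<m. \<integral>t. g (to_circle (real k / real m)) * indicator (?J k) t \<partial>?M)"
      unfolding s_def by (intro Bochner_Integration.integral_sum integrable_mult_right indi) simp
    also have "\<dots> = (\<Sum>k<m. g (to_circle (real k / real m)) * (1 / m))"
    proof (rule sum.cong)
      fix k assume "k \<in> {..<m}"
      then have k: "k < m" by simp
      have "?J k \<inter> space ?M = ?J k" using J[OF k] by auto
      then show "(\<integral>t. g (to_circle (real k / real m)) * indicator (?J k) t \<partial>?M)
          = g (to_circle (real k / real m)) * (1 / m)"
        by (simp only: integral_mult_right_zero Bochner_Integration.integral_indicator mJ[OF k])
    qed simp
    finally show ?thesis .
  qed
  then have ints: "(\<integral>t. s t \<partial>?M) = (\<Sum>k<m. g (to_circle (real k / real m))) / m"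
    by (simp add: sum_divide_distrib)
  have "\<bar>g (to_circle t) - s t\<bar> \<le> K / m" if t: "0 \<le> t" "t < 1" for t
  proof -
    define k where "k = nat \<lfloor>t * m\<rfloor>"
    have k: "real k \<le> t * m" "t * m < real k + 1" using t by (simp_all add: k_def)
    have "real k < m" using k t m by (smt (verit) mult_less_cancel_right2 of_nat_0_less_iff)
    then have km: "k < m" by simp
    have "j = k" if "real j \<le> t * m" "t * m < real j + 1" for j using k that by linarith
    then have ind: "indicator (?J j) t = (if j = k then 1 else 0 :: real)" for j
      using k m by (auto simp: indicator_def field_simps)
    have "s t = (\<Sum>j<m. if j = k then g (to_circle (real j / real m)) else 0)"
      unfolding s_def ind by (rule sum.cong) auto
    also have "\<dots> = g (to_circle (real k / real m))" using km by simp
    finally have "\<bar>g (to_circle t) - s t\<bar> \<le> K * dist (to_circle t) (to_circle (real k / real m))"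
      using lip by simp
    also have "\<dots> \<le> K * dist t (real k / real m)"
      by (rule mult_left_mono[OF dist_to_circle K])
    also have "\<dots> \<le> K * (1 / m)"
    proof (rule mult_left_mono[OF _ K])
      have "real k / real m \<le> t" "t \<le> real k / real m + 1 / m"
        using k m by (simp_all add: field_simps)
      then show "dist t (real k / real m) \<le> 1 / m" by (simp add: dist_real_def)
    qed
    finally show ?thesis by simp
  qed
  then have "\<bar>\<integral>t. g (to_circle t) - s t \<partial>?M\<bar> \<le> K / m"
    using gi si by (intro M.abs_integral_le_const) auto
  moreover have "(\<integral>a. g a \<partial>haar) = (\<integral>t. g (to_circle t) \<partial>?M)"
    unfolding haar_def by (rule integral_distr) auto
  ultimately show ?thesis using gi si by (simp add: ints)
qed

text \<open>Fubini and one Riemann sum per coordinate, each costing \<open>K / m\<close>. The error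
  grows with the dimension, which is harmless because the mesh is chosen after it.\<close>

lemma torus_quadrature:
  assumes m: "m > 0" and K: "K \<ge> 0" and "distinct ns"
    and "h \<in> borel_measurable (torus_haar (set ns))"
    and "\<And>x. x \<in> set ns \<rightarrow>\<^sub>E UNIV \<Longrightarrow> \<bar>h x\<bar> \<le> B"
    and "\<And>n a b x. n \<in> set ns \<Longrightarrow> x \<in> set ns \<rightarrow>\<^sub>E UNIV
      \<Longrightarrow> \<bar>h (x(n := a)) - h (x(n := b))\<bar> \<le> K * dist a b"
  shows "\<bar>(\<integral>x. h x \<partial>torus_haar (set ns)) - mean m ns (\<lambda>w. h (grid m (set ns) w)) w\<bar>
    \<le> length ns * (K / m)"
  using assms(3-)
proof (induction ns arbitrary: h w)
  case Nil
  interpret prob_space "torus_haar {}" by (rule prob_space_torus_haar)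
  \<comment> \<open>The torus over the empty set has one point, the function that is
    \<open>undefined\<close> everywhere.\<close>
  have "(\<integral>x. h x \<partial>torus_haar {}) = (\<integral>x. h (\<lambda>_. undefined) \<partial>torus_haar {})"
    by (rule Bochner_Integration.integral_cong) (auto simp: space_torus_haar)
  moreover have "grid m {} w = (\<lambda>_. undefined)" by (simp add: grid_def fun_eq_iff)
  ultimately show ?case by (simp add: prob_space)
next
  case (Cons n ns)
  let ?I = "set ns" and ?c = "\<lambda>k. to_circle (real k / real m)"
  have n: "n \<notin> ?I" "distinct ns" using Cons.prems by auto
  interpret product_sigma_finite "\<lambda>_::nat. haar"
    by standard
  interpret I: prob_space "torus_haar ?I" by (rule prob_space_torus_haar)
  interpret J: prob_space "torus_haar (insert n ?I)" by (rule prob_space_torus_haar)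
  have hm: "h \<in> borel_measurable (torus_haar (insert n ?I))" using Cons.prems by simp
  have hB: "\<bar>h x\<bar> \<le> B" if "x \<in> insert n ?I \<rightarrow>\<^sub>E UNIV" for x using Cons.prems that by simp
  have lip: "\<bar>h (x(l := a)) - h (x(l := b))\<bar> \<le> K * dist a b"
    if "l \<in> insert n ?I" "x \<in> insert n ?I \<rightarrow>\<^sub>E UNIV" for l a b x
    using Cons.prems(4)[of l x a b] that by (simp only: list.set)
  have mem: "x(n := a) \<in> insert n ?I \<rightarrow>\<^sub>E UNIV" if "x \<in> ?I \<rightarrow>\<^sub>E UNIV" for x and a :: circle
    using that by (auto simp: PiE_def extensional_def)
  have joint: "(\<lambda>(x, y). h (x(n := y))) \<in> borel_measurable (torus_haar ?I \<Otimes>\<^sub>M haar)"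
    using measurable_compose[OF measurable_add_dim hm[unfolded torus_haar_def]]
    by (simp add: torus_haar_def case_prod_beta)
  have int: "integrable (torus_haar ?I) (\<lambda>x. h (x(n := a)))" for a
    using measurable_compose[OF measurable_Pair2' joint, of a] hB[OF mem]
    by (intro I.integrable_const_bound[where B = B]) (auto simp: space_torus_haar)
  define g where "g x = (\<integral>y. h (x(n := y)) \<partial>haar)" for x
  have hy: "(\<lambda>y. h (x(n := y))) \<in> borel_measurable haar" if "x \<in> ?I \<rightarrow>\<^sub>E UNIV" for x
    using measurable_compose_Pair1[OF _ joint, of x] that by (simp add: space_torus_haar)
  have gm: "g \<in> borel_measurable (torus_haar ?I)"
    unfolding g_def by (rule haar.borel_measurable_lebesgue_integral[OF joint])
  have gB: "\<bar>g x\<bar> \<le> B" if "x \<in> ?I \<rightarrow>\<^sub>E UNIV" for x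
    unfolding g_def
    by (intro haar.abs_integral_le_const haar.integrable_const_bound[where B = B])
      (use hB[OF mem[OF that]] hy[OF that] in auto)
  have gi: "integrable (torus_haar ?I) g"
    using gm gB by (intro I.integrable_const_bound[where B = B]) (auto simp: space_torus_haar)
  have hi: "integrable (torus_haar (insert n ?I)) h"
    using hm hB by (intro J.integrable_const_bound[where B = B]) (auto simp: space_torus_haar)
  have fub: "(\<integral>x. h x \<partial>torus_haar (insert n ?I)) = (\<integral>x. g x \<partial>torus_haar ?I)"
    unfolding g_def torus_haar_def
    by (rule product_integral_insert) (use n hi in \<open>auto simp: torus_haar_def\<close>)
  have "\<bar>g x - (\<Sum>k<m. h (x(n := ?c k))) / m\<bar> \<le> K / m" if x: "x \<in> ?I \<rightarrow>\<^sub>E UNIV" for x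
    unfolding g_def
  proof (rule circle_quadrature[OF m _ _ _ K])
    show "(\<lambda>y. h (x(n := y))) \<in> borel_measurable borel"
      using hy[OF x] by simp
    show "\<bar>h (x(n := a))\<bar> \<le> B" for a by (rule hB[OF mem[OF x]])
    show "\<bar>h (x(n := a)) - h (x(n := b))\<bar> \<le> K * dist a b" for a b
      using lip[of n "x(n := a)" a b] mem[OF x] by simp
  qed
  then have "\<bar>\<integral>x. g x - (\<Sum>k<m. h (x(n := ?c k))) / m \<partial>torus_haar ?I\<bar> \<le> K / m"
    using gi int by (intro I.abs_integral_le_const) (auto simp: space_torus_haar)
  then have 1: "\<bar>(\<integral>x. g x \<partial>torus_haar ?I)
      - (\<Sum>k<m. \<integral>x. h (x(n := ?c k)) \<partial>torus_haar ?I) / m\<bar> \<le> K / m"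
    using gi int by simp
  \<comment> \<open>The induction hypothesis is applied to the slices of \<open>h\<close> whose
    coordinate \<open>n\<close> is frozen at a grid point.\<close>
  have IH: "\<bar>(\<integral>x. h (x(n := ?c k)) \<partial>torus_haar ?I)
      - mean m ns (\<lambda>w. h ((grid m ?I w)(n := ?c k))) w\<bar> \<le> length ns * (K / m)" for k
  proof (rule Cons.IH[OF n(2)])
    show "(\<lambda>x. h (x(n := ?c k))) \<in> borel_measurable (torus_haar ?I)" using int by auto
    show "\<bar>h (x(n := ?c k))\<bar> \<le> B" if "x \<in> ?I \<rightarrow>\<^sub>E UNIV" for x
      by (rule hB[OF mem[OF that]])
    show "\<bar>h ((x(l := a))(n := ?c k)) - h ((x(l := b))(n := ?c k))\<bar> \<le> K * dist a b"
      if "l \<in> ?I" "x \<in> ?I \<rightarrow>\<^sub>E UNIV" for l a b x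
    proof -
      have "l \<noteq> n" using that n by auto
      then show ?thesis
        using lip[of l "x(n := ?c k)" a b] mem[OF that(2)] that(1) fun_upd_twist[of l n x] by auto
    qed
  qed
  have "\<bar>(\<Sum>k<m. \<integral>x. h (x(n := ?c k)) \<partial>torus_haar ?I)
      - (\<Sum>k<m. mean m ns (\<lambda>w. h ((grid m ?I w)(n := ?c k))) w)\<bar> \<le> (\<Sum>k<m. length ns * (K / m))"
    unfolding sum_subtractf[symmetric] by (intro order_trans[OF sum_abs] sum_mono IH)
  then have "\<bar>(\<Sum>k<m. \<integral>x. h (x(n := ?c k)) \<partial>torus_haar ?I)
      - (\<Sum>k<m. mean m ns (\<lambda>w. h ((grid m ?I w)(n := ?c k))) w)\<bar> / m
      \<le> m * (length ns * (K / m)) / m"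
    by (intro divide_right_mono) auto
  then have 2: "\<bar>(\<Sum>k<m. \<integral>x. h (x(n := ?c k)) \<partial>torus_haar ?I) / m
      - (\<Sum>k<m. mean m ns (\<lambda>w. h ((grid m ?I w)(n := ?c k))) w) / m\<bar> \<le> length ns * (K / m)"
    using m by (simp add: abs_divide flip: diff_divide_distrib)
  have "grid m (insert n ?I) (w(n := k)) = (grid m ?I w)(n := ?c k)" for w k
    by (auto simp: grid_def fun_eq_iff)
  then have "mean m ns (\<lambda>w. h (grid m (insert n ?I) w)) (w(n := k))
      = mean m ns (\<lambda>w. h ((grid m ?I w)(n := ?c k))) w" for k
    unfolding mean_upd_other[OF n(1)] by presburger
  then have "mean m (n # ns) (\<lambda>w. h (grid m (insert n ?I) w)) w
      = (\<Sum>k<m. mean m ns (\<lambda>w. h ((grid m ?I w)(n := ?c k))) w) / m"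
    unfolding mean.simps mean1_def by presburger
  then have "\<bar>(\<integral>x. h x \<partial>torus_haar (insert n ?I))
      - mean m (n # ns) (\<lambda>w. h (grid m (insert n ?I) w)) w\<bar> \<le> K / m + length ns * (K / m)"
    using 1 2 unfolding fub by linarith
  then show ?case by (simp add: algebra_simps)
qed

section \<open>Lipschitz functions and their conditional expectations at grid points\<close>

lemma torus_1_lipschitz_le:
  assumes N: "N \<ge> 1" and f: "torus_1_lipschitz N f"
    and "x \<in> {1..N} \<rightarrow>\<^sub>E UNIV" "y \<in> {1..N} \<rightarrow>\<^sub>E UNIV"
    and "\<And>n. n \<in> {1..N} \<Longrightarrow> dist (x n) (y n) \<le> c"
  shows "\<bar>f x - f y\<bar> \<le> c"
proof -
  have "\<bar>f x - f y\<bar> \<le> torus_dist N x y" using f assms(3,4) by (auto simp: torus_1_lipschitz_def)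
  also have "\<dots> \<le> c" unfolding torus_dist_def using N assms(5) by (subst Max_le_iff) auto
  finally show ?thesis .
qed

lemma torus_1_lipschitz_upd:
  assumes N: "N \<ge> 1" and f: "torus_1_lipschitz N f"
    and x: "x \<in> {1..N} \<rightarrow>\<^sub>E UNIV" and n: "n \<in> {1..N}"
  shows "\<bar>f (x(n := a)) - f (x(n := b))\<bar> \<le> dist a b"
  by (rule torus_1_lipschitz_le[OF N f]) (use x n in \<open>auto simp: PiE_def extensional_def\<close>)

lemma torus_1_lipschitz_grid:
  assumes N: "N \<ge> 1" and f: "torus_1_lipschitz N f" and m: "m > 0"
    and "\<And>n. n \<in> {1..N} \<Longrightarrow> \<bar>real (w n) - real (v n)\<bar> \<le> c"
  shows "\<bar>f (grid m {1..N} w) - f (grid m {1..N} v)\<bar> \<le> c / m"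
proof (rule torus_1_lipschitz_le[OF N f])
  fix n assume n: "n \<in> {1..N}"
  have "dist (grid m {1..N} w n) (grid m {1..N} v n) \<le> \<bar>real (w n) / m - real (v n) / m\<bar>"
    using n dist_to_circle[of "real (w n) / m" "real (v n) / m"] by (simp add: grid_def dist_real_def)
  also have "\<dots> \<le> c / m"
    using assms(4)[OF n] m by (simp add: abs_divide divide_right_mono flip: diff_divide_distrib)
  finally show "dist (grid m {1..N} w n) (grid m {1..N} v n) \<le> c / m" .
qed (auto simp: grid_def)

lemma merge_mem_torus:
  "S \<subseteq> {1..N} \<Longrightarrow> merge S ({1..N} - S) (x, y) \<in> {1..N} \<rightarrow>\<^sub>E (UNIV :: circle set)"
  by (auto simp: merge_def PiE_def extensional_def)

text \<open>Integration does not enlarge the Lipschitz constant, and changing a coordinate outside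
  \<open>S\<close> leaves the merged point as it was.\<close>

lemma torus_cond_exp_upd:
  assumes N: "N \<ge> 1" and f: "torus_1_lipschitz N f" and S: "S \<subseteq> {1..N}"
    and x: "x \<in> {1..N} \<rightarrow>\<^sub>E UNIV" and n: "n \<in> {1..N}"
  shows "\<bar>torus_cond_exp N S f (x(n := a)) - torus_cond_exp N S f (x(n := b))\<bar> \<le> dist a b"
proof -
  let ?T = "{1..N} - S"
  interpret prob_space "torus_haar ?T" by (rule prob_space_torus_haar)
  have int: "integrable (torus_haar ?T) (\<lambda>y. f (merge S ?T (x(n := c), y)))" for c
    by (rule torus_cond_exp_integrable(2)[OF N f S])
      (use x n in \<open>auto simp: PiE_def extensional_def\<close>)
  have "\<bar>f (merge S ?T (x(n := a), y)) - f (merge S ?T (x(n := b), y))\<bar> \<le> dist a b" for y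
    by (rule torus_1_lipschitz_le[OF N f merge_mem_torus[OF S] merge_mem_torus[OF S]])
      (auto simp: merge_def)
  then have "\<bar>\<integral>y. f (merge S ?T (x(n := a), y)) - f (merge S ?T (x(n := b), y)) \<partial>torus_haar ?T\<bar>
      \<le> dist a b"
    by (intro abs_integral_le_const Bochner_Integration.integrable_diff int)
  then show ?thesis unfolding torus_cond_exp_def Bochner_Integration.integral_diff[OF int int] .
qed

text \<open>Quadrature in the coordinates of \<open>ts\<close>: there are at most \<open>N\<close>
  of them, and \<open>f\<close> has Lipschitz constant 1 in each.\<close>

lemma torus_cond_exp_grid:
  assumes N: "N \<ge> 1" and f: "torus_1_lipschitz N f" and m: "m > 0"
    and ts: "distinct ts" "set ts \<subseteq> {1..N}"
  shows "\<bar>torus_cond_exp N ({1..N} - set ts) f (grid m {1..N} w)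
      - mean m ts (\<lambda>w. f (grid m {1..N} w)) w\<bar> \<le> N / m"
proof -
  let ?T = "set ts" and ?S = "{1..N} - set ts" and ?x = "grid m {1..N} w"
  have T: "{1..N} - ?S = ?T" using ts by auto
  have S: "?S \<subseteq> {1..N}" by auto
  have x: "?x \<in> {1..N} \<rightarrow>\<^sub>E UNIV" by (simp add: grid_def)
  note merge_mem = merge_mem_torus[OF S, unfolded T]
  obtain B where B: "\<And>x. x \<in> {1..N} \<rightarrow>\<^sub>E UNIV \<Longrightarrow> \<bar>f x\<bar> \<le> B"
    using torus_1_lipschitz_bounded[OF N f] by blast
  have "\<bar>(\<integral>y. f (merge ?S ?T (?x, y)) \<partial>torus_haar ?T)
      - mean m ts (\<lambda>z. f (merge ?S ?T (?x, grid m ?T z))) w\<bar> \<le> length ts * (1 / m)"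
  proof (rule torus_quadrature[OF m _ ts(1)])
    show "(\<lambda>y. f (merge ?S ?T (?x, y))) \<in> borel_measurable (torus_haar ?T)"
      using torus_cond_exp_integrable(2)[OF N f S x] unfolding T by auto
    show "\<bar>f (merge ?S ?T (?x, y))\<bar> \<le> B" for y by (rule B[OF merge_mem])
    show "\<bar>f (merge ?S ?T (?x, y(n := a))) - f (merge ?S ?T (?x, y(n := b)))\<bar> \<le> 1 * dist a b" for n a b y
      by (rule torus_1_lipschitz_le[OF N f merge_mem merge_mem]) (auto simp: merge_def)
  qed simp
  \<comment> \<open>The average only visits points that agree with \<open>w\<close> off
    \<open>ts\<close>, where merging reproduces the grid point.\<close>
  also have "mean m ts (\<lambda>z. f (merge ?S ?T (?x, grid m ?T z))) w
      = mean m ts (\<lambda>w. f (grid m {1..N} w)) w"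
  proof (rule mean_cong_on)
    fix z assume z: "\<forall>i. i \<notin> ?T \<longrightarrow> z i = w i"
    have "merge ?S ?T (?x, grid m ?T z) = grid m {1..N} z"
      using z ts by (auto simp: merge_def grid_def fun_eq_iff)
    then show "f (merge ?S ?T (?x, grid m ?T z)) = f (grid m {1..N} z)" by simp
  qed
  also have "real (length ts) * (1 / m) \<le> N / m"
    using card_mono[OF _ ts(2)] distinct_card[OF ts(1)] by (simp add: divide_right_mono)
  finally show ?thesis unfolding torus_cond_exp_def T .
qed

text \<open>Quadrature of an integrand with Lipschitz constant 2 in each coordinate costs
  \<open>2 * N / m\<close>; replacing the conditional expectation by the grid average costs another
  \<open>N / m\<close>.\<close>

lemma torus_L1_norm_cond_exp_le:
  assumes N: "N \<ge> 1" and f: "torus_1_lipschitz N f" and m: "m > 0"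
    and ns: "distinct ns" "set ns = {1..N}" and ts: "distinct ts" "set ts \<subseteq> {1..N}"
  defines "F \<equiv> \<lambda>w. f (grid m {1..N} w)"
  shows "torus_L1_norm N (\<lambda>x. f x - torus_cond_exp N ({1..N} - set ts) f x)
    \<le> mean m ns (\<lambda>w. \<bar>F w - mean m ts F w\<bar>) w + 3 * N / m"
proof -
  let ?S = "{1..N} - set ts"
  let ?h = "\<lambda>x. \<bar>f x - torus_cond_exp N ?S f x\<bar>"
  have S: "?S \<subseteq> {1..N}" by auto
  interpret prob_space "torus_haar {1..N}" by (rule prob_space_torus_haar)
  obtain B where B: "\<And>x. x \<in> {1..N} \<rightarrow>\<^sub>E UNIV \<Longrightarrow> \<bar>f x\<bar> \<le> B"
    using torus_1_lipschitz_bounded[OF N f] by blast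
  have CB: "\<bar>torus_cond_exp N ?S f x\<bar> \<le> B" if "x \<in> {1..N} \<rightarrow>\<^sub>E UNIV" for x
    unfolding torus_cond_exp_def
    by (rule prob_space.abs_integral_le_const[OF prob_space_torus_haar
          torus_cond_exp_integrable(2)[OF N f S that]]) (rule B[OF merge_mem_torus[OF S]])
  have "\<bar>(\<integral>x. ?h x \<partial>torus_haar (set ns)) - mean m ns (\<lambda>w. ?h (grid m (set ns) w)) w\<bar>
    \<le> length ns * (2 / m)"
  proof (rule torus_quadrature[OF m _ ns(1)])
    show "?h \<in> borel_measurable (torus_haar (set ns))"
      unfolding ns using torus_cond_exp_integrable(1,3)[OF N f S] by auto
    show "\<bar>?h x\<bar> \<le> 2 * B" if "x \<in> set ns \<rightarrow>\<^sub>E UNIV" for x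
      using B[of x] CB[of x] that unfolding ns by linarith
    show "\<bar>?h (x(n := a)) - ?h (x(n := b))\<bar> \<le> 2 * dist a b"
      if "n \<in> set ns" "x \<in> set ns \<rightarrow>\<^sub>E UNIV" for n a b x
      using torus_1_lipschitz_upd[OF N f, of x n a b] torus_cond_exp_upd[OF N f S, of x n a b] that
      unfolding ns by linarith
  qed simp
  then have "torus_L1_norm N (\<lambda>x. f x - torus_cond_exp N ?S f x)
      \<le> mean m ns (\<lambda>w. ?h (grid m {1..N} w)) w + 2 * N / m"
    using distinct_card[OF ns(1)] unfolding ns torus_L1_norm_def abs_le_iff by (simp add: mult.commute)
  also have "mean m ns (\<lambda>w. ?h (grid m {1..N} w)) w
      \<le> mean m ns (\<lambda>w. \<bar>F w - mean m ts F w\<bar> + N / m) w"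
  proof (rule mean_mono)
    fix w
    show "?h (grid m {1..N} w) \<le> \<bar>F w - mean m ts F w\<bar> + N / m"
      using torus_cond_exp_grid[OF N f m ts, of w] unfolding F_def by linarith
  qed
  finally show ?thesis by (simp add: mean_add mean_const[OF m])
qed

section \<open>Choice of the constants and return from the grid to the torus\<close>

theorem theorem1p2:
  fixes \<epsilon> :: real
  assumes "\<epsilon> > 0"
  shows "\<exists>q :: nat. q \<ge> 1 \<and>
    (\<forall>N :: nat. \<forall>f :: (nat \<Rightarrow> circle) \<Rightarrow> real. N \<ge> 1 \<longrightarrow> torus_1_lipschitz N f \<longrightarrow>
      (\<exists>S. S \<subseteq> {1..N} \<and> card S \<le> q \<and>
        torus_L1_norm N (\<lambda>x. f x - torus_cond_exp N S f x) < \<epsilon>))"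
proof -
  \<comment> \<open>With \<open>C = 4\<close>, these values make both
    \<open>4 * C\<^sup>2 / ln M\<close> and \<open>M * \<delta> * C\<close> equal to
    \<open>\<epsilon>\<^sup>2 / 8\<close>, so they add up to
    \<open>(\<epsilon> / 2)\<^sup>2\<close>. They depend on \<open>\<epsilon>\<close> alone, and so
    does \<open>q\<close>.\<close>
  define M where "M = exp (512 / \<epsilon>\<^sup>2)"
  define \<delta> where "\<delta> = \<epsilon>\<^sup>2 / (32 * M)"
  define q where "q = nat \<lceil>4 / \<delta>\<rceil> + 1"
  have M: "M > 1" "ln M = 512 / \<epsilon>\<^sup>2" using assms by (simp_all add: M_def)
  have \<delta>: "\<delta> > 0" using assms M by (simp add: \<delta>_def)
  have "\<exists>S. S \<subseteq> {1..N} \<and> card S \<le> q \<and> torus_L1_norm N (\<lambda>x. f x - torus_cond_exp N S f x) < \<epsilon>"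
    if N: "N \<ge> 1" and f: "torus_1_lipschitz N f" for N f
  proof -
    \<comment> \<open>This mesh gives \<open>N / m \<le> \<epsilon> / 12\<close>, so that a total
      discretization error of \<open>5 * (N / m)\<close> stays below
      \<open>\<epsilon> / 2\<close>.\<close>
    define m where "m = nat \<lceil>12 * N / \<epsilon>\<rceil> + 1"
    define ns where "ns = [1..<Suc N]"
    define F where "F w = f (grid m {1..N} w)" for w
    \<comment> \<open>The box side \<open>N\<close> cancels the number of coordinates: the
      differences of \<open>P\<close> sum to at most \<open>2 / m + N * (2 / (m * N))\<close>, that
      is \<open>4 / m\<close>.\<close>
    define P where "P = smooth N ns F"
    define z where "z = (\<lambda>_::nat. 0::nat)"
    have m: "m > 0" by (simp add: m_def)
    have "12 * N / \<epsilon> \<le> m" using real_nat_ceiling_ge[of "12 * N / \<epsilon>"] unfolding m_def of_nat_add by simp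
    then have Nm: "N / m \<le> \<epsilon> / 12" using assms m by (simp add: field_simps)
    have ns: "distinct ns" "set ns = {1..N}" by (auto simp: ns_def)
    have "\<bar>F (bump B w) - F w\<bar> \<le> 1 / m" for B w
      unfolding F_def by (rule torus_1_lipschitz_grid[OF N f m]) (auto simp: bump_def)
    then have "(\<Sum>i\<in>set ns. \<bar>fdiff i P w\<bar>) \<le> 2 * (1 / m) + card (set ns) * (2 * (1 / m) / N)" for w
      unfolding P_def using N by (intro sum_abs_fdiff_smooth_le) auto
    then have TV: "(\<Sum>i\<in>set ns. \<bar>fdiff i P w\<bar>) \<le> 4 / real m" for w
      using N by (simp add: ns(2))
    obtain ts where ts: "distinct ts" "set ts \<subseteq> {1..N}"
      and card: "\<delta> * card ({1..N} - set ts) \<le> 4"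
      and sq: "(mean m ns (\<lambda>y. \<bar>P y - mean m ts P y\<bar>) z)\<^sup>2 \<le> 4 * 4\<^sup>2 / ln M + M * \<delta> * 4"
      using mean_junta[OF m M(1) \<delta> ns(1) TV, of z] unfolding ns(2) by auto
    have "4 * 4\<^sup>2 / ln M + M * \<delta> * 4 = (\<epsilon> / 2)\<^sup>2"
    proof -
      have "M * \<delta> = \<epsilon>\<^sup>2 / 32" using M(1) by (simp add: \<delta>_def)
      then show ?thesis unfolding M(2) by (simp add: power_divide)
    qed
    from sq[unfolded this] have PL1: "mean m ns (\<lambda>y. \<bar>P y - mean m ts P y\<bar>) z \<le> \<epsilon> / 2"
      by (rule power2_le_imp_le) (use assms in simp)
    \<comment> \<open>Smoothing shifts each coordinate by less than \<open>N\<close> cells of length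
      \<open>1 / m\<close>.\<close>
    have FP: "\<bar>F w - P w\<bar> \<le> N / m" for w
    proof -
      have "F w - P w = mean N ns (\<lambda>u. F w - F (\<lambda>i. w i + u i)) (\<lambda>_. 0)"
        using N by (simp add: P_def smooth_def mean_diff mean_const)
      also have "\<bar>\<dots>\<bar> \<le> N / m"
      proof (rule abs_mean_le_bound)
        fix u :: "nat \<Rightarrow> nat" assume "\<forall>i\<in>set ns. u i < N"
        then show "\<bar>F w - F (\<lambda>i. w i + u i)\<bar> \<le> N / m"
          unfolding F_def ns(2)
          by (intro torus_1_lipschitz_grid[OF N f m]) (auto simp: less_imp_le)
      qed (use N in simp)
      finally show ?thesis .
    qed
    have mFP: "\<bar>mean m ts F w - mean m ts P w\<bar> \<le> N / m" for w
      unfolding mean_diff[symmetric] by (rule abs_mean_le_bound[OF m]) (rule FP)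
    have "mean m ns (\<lambda>w. \<bar>F w - mean m ts F w\<bar>) z
        \<le> mean m ns (\<lambda>w. \<bar>P w - mean m ts P w\<bar> + 2 * (N / m)) z"
    proof (rule mean_mono)
      fix w
      show "\<bar>F w - mean m ts F w\<bar> \<le> \<bar>P w - mean m ts P w\<bar> + 2 * (N / m)"
        using FP[of w] mFP[of w] by linarith
    qed
    then have FL1: "mean m ns (\<lambda>w. \<bar>F w - mean m ts F w\<bar>) z \<le> \<epsilon> / 2 + 2 * (N / m)"
      using PL1 by (simp add: mean_add mean_const[OF m])
    \<comment> \<open>Of the five errors \<open>N / m\<close>, two come from smoothing
      \<open>F\<close> and its average, three from passing between torus and grid.\<close>
    have "torus_L1_norm N (\<lambda>x. f x - torus_cond_exp N ({1..N} - set ts) f x) \<le> \<epsilon> / 2 + 5 * (N / m)"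
      using torus_L1_norm_cond_exp_le[OF N f m ns ts, of z] FL1 unfolding F_def by simp
    then have "torus_L1_norm N (\<lambda>x. f x - torus_cond_exp N ({1..N} - set ts) f x) < \<epsilon>"
      using Nm assms by linarith
    moreover have "card ({1..N} - set ts) \<le> q"
    proof -
      have "real (card ({1..N} - set ts)) \<le> 4 / \<delta>" using card \<delta> by (simp add: field_simps)
      also have "\<dots> \<le> q" using real_nat_ceiling_ge[of "4 / \<delta>"] unfolding q_def of_nat_add by simp
      finally show ?thesis by simp
    qed
    moreover have "{1..N} - set ts \<subseteq> {1..N}" by (rule Diff_subset)
    ultimately show ?thesis by (intro exI conjI)
  qed
  moreover have "q \<ge> 1" by (simp add: q_def)
  ultimately show ?thesis by (intro exI[of _ q]) simp
qed

end
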